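(* Let $C$ be a cardioid-like curve and $T$ a deltoid-like curve, and let $T_{\rm conc}$ be an arc of $T$ between two cusps which has negative curvature and total tangent-direction variation less than $\pi$. Then there is a similarity $\phi$ of the plane (a composition of a rotation, a translation and a uniform scaling) such that $\phi(C)$ is inscribed in $T$ (i.e. $\phi(C)$ lies in the closure of the bounded domain enclosed by $T$), $\phi(C)$ intersects all three sides of $T$ (the three arcs between cusps), and $\phi(C)$ intersects $T_{\rm conc}$ at two points.
   Context: A Jordan curve is cardioid-like if it is smooth and has positive curvature with respect to counterclockwise orientation except at a single (inward) cusp singularity. A Jordan curve is deltoid-like if it is smooth except at three outward cusps and at least one of the arcs between the cusp points has negative curvature with total variation of the tangent direction along the arc less than $\pi$. *)

theory Defs
  imports "HOL-Complex_Analysis.Winding_Numbers"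
begin

text \<open>Plane = complex numbers. A closed curve is given by a 1-periodic
  parametrisation g :: real => complex whose restriction to [0,1] is a simple
  closed path (Jordan curve).\<close>

primrec vd_iter :: "nat \<Rightarrow> (real \<Rightarrow> complex) \<Rightarrow> real \<Rightarrow> complex" where
  "vd_iter 0 g = g"
| "vd_iter (Suc n) g = (\<lambda>t. vector_derivative (vd_iter n g) (at t))"

definition smooth_regular_on :: "(real \<Rightarrow> complex) \<Rightarrow> real set \<Rightarrow> bool" where
  "smooth_regular_on g S \<longleftrightarrow> open S \<and>
     (\<forall>n. \<forall>t\<in>S. (vd_iter n g has_vector_derivative vd_iter (Suc n) g t) (at t)) \<and>
     (\<forall>t\<in>S. vd_iter 1 g t \<noteq> 0)"

definition curvature :: "(real \<Rightarrow> complex) \<Rightarrow> real \<Rightarrow> real" where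
  "curvature g t = Im (cnj (vd_iter 1 g t) * vd_iter 2 g t) / (norm (vd_iter 1 g t)) ^ 3"

definition jordan_param :: "(real \<Rightarrow> complex) \<Rightarrow> bool" where
  "jordan_param g \<longleftrightarrow> (\<forall>t. g (t + 1) = g t) \<and> continuous_on UNIV g \<and> simple_path g"

definition ccw :: "(real \<Rightarrow> complex) \<Rightarrow> bool" where
  "ccw g \<longleftrightarrow> (\<forall>z\<in>inside (path_image g). winding_number g z = 1)"

text \<open>Cusp at parameter t0 with cusp direction v: the unit tangent tends to v from
  the right and to -v from the left (both branches leave the cusp point in direction v).\<close>
definition cusp :: "(real \<Rightarrow> complex) \<Rightarrow> real \<Rightarrow> complex \<Rightarrow> bool" where
  "cusp g t0 v \<longleftrightarrow> norm v = 1 \<and>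
     ((\<lambda>t. vd_iter 1 g t / complex_of_real (norm (vd_iter 1 g t))) \<longlongrightarrow> v) (at_right t0) \<and>
     ((\<lambda>t. vd_iter 1 g t / complex_of_real (norm (vd_iter 1 g t))) \<longlongrightarrow> - v) (at_left t0)"

definition inward_cusp :: "(real \<Rightarrow> complex) \<Rightarrow> real \<Rightarrow> bool" where
  "inward_cusp g t0 \<longleftrightarrow> (\<exists>v. cusp g t0 v \<and>
     (\<forall>\<^sub>F s in at_right 0. g t0 - complex_of_real s * v \<in> inside (path_image g)))"

definition outward_cusp :: "(real \<Rightarrow> complex) \<Rightarrow> real \<Rightarrow> bool" where
  "outward_cusp g t0 \<longleftrightarrow> (\<exists>v. cusp g t0 v \<and>
     (\<forall>\<^sub>F s in at_right 0. g t0 - complex_of_real s * v \<in> outside (path_image g)))"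

definition cardioid_param :: "(real \<Rightarrow> complex) \<Rightarrow> real \<Rightarrow> bool" where
  "cardioid_param g t0 \<longleftrightarrow> jordan_param g \<and> ccw g \<and>
     smooth_regular_on g {t. \<forall>k::int. t \<noteq> t0 + of_int k} \<and>
     (\<forall>t. (\<forall>k::int. t \<noteq> t0 + of_int k) \<longrightarrow> curvature g t > 0) \<and>
     inward_cusp g t0"

definition cardioid_like :: "complex set \<Rightarrow> bool" where
  "cardioid_like C \<longleftrightarrow> (\<exists>g t0. cardioid_param g t0 \<and> C = path_image g)"

definition deltoid_param :: "(real \<Rightarrow> complex) \<Rightarrow> real \<Rightarrow> real \<Rightarrow> real \<Rightarrow> bool" where
  "deltoid_param g t1 t2 t3 \<longleftrightarrow> jordan_param g \<and> ccw g \<and> t1 < t2 \<and> t2 < t3 \<and> t3 < t1 + 1 \<and>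
     smooth_regular_on g {t. \<forall>k::int. t \<noteq> t1 + of_int k \<and> t \<noteq> t2 + of_int k \<and> t \<noteq> t3 + of_int k} \<and>
     outward_cusp g t1 \<and> outward_cusp g t2 \<and> outward_cusp g t3"

definition tangent_variation_less :: "(real \<Rightarrow> complex) \<Rightarrow> real \<Rightarrow> real \<Rightarrow> real \<Rightarrow> bool" where
  "tangent_variation_less g a b c \<longleftrightarrow>
     (\<exists>V. ((\<lambda>t. \<bar>curvature g t\<bar> * norm (vd_iter 1 g t)) has_integral V) {a..b} \<and> V < c)"

definition concave_arc :: "(real \<Rightarrow> complex) \<Rightarrow> real \<Rightarrow> real \<Rightarrow> bool" where
  "concave_arc g a b \<longleftrightarrow> (\<forall>t\<in>{a<..<b}. curvature g t < 0) \<and> tangent_variation_less g a b pi"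

definition deltoid_like :: "complex set \<Rightarrow> bool" where
  "deltoid_like T \<longleftrightarrow> (\<exists>g t1 t2 t3. deltoid_param g t1 t2 t3 \<and> T = path_image g \<and>
     (concave_arc g t1 t2 \<or> concave_arc g t2 t3 \<or> concave_arc g t3 (t1 + 1)))"

definition similarity :: "(complex \<Rightarrow> complex) \<Rightarrow> bool" where
  "similarity \<phi> \<longleftrightarrow> (\<exists>a b. a \<noteq> 0 \<and> \<phi> = (\<lambda>z. a * z + b))"

end

theory Submission
  imports Defs "HOL-Complex_Analysis.Riemann_Mapping"
begin

text \<open>
  Parametrise the cardioid by its tangent angle. Hopf's secant argument, with the cusp as base point,
  shows that the angle runs through an interval of length \<open>3\<pi>\<close>: near the cusp all secants between the
  two branches lie in a half-plane, and the rotation of the curve seen from the cusp is the winding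
  number around a point just behind the cusp, which is one because the cusp points inward. Hence the
  cardioid has two feet, one on each side of the cusp, which realise the same tangent directions.

  Since the concave arc turns by less than \<open>\<pi>\<close>, for any two of its points \<open>g s\<^sub>1\<close>, \<open>g s\<^sub>2\<close> with
  \<open>s\<^sub>1 < s\<^sub>2\<close> there is exactly one similarity that puts the left foot tangentially on \<open>g s\<^sub>1\<close> and the
  right foot tangentially on \<open>g s\<^sub>2\<close>. It depends continuously on \<open>(s\<^sub>1, s\<^sub>2)\<close>, shrinks to a point on the
  diagonal, and the copy of the cardioid meets the arc in no third point, because every other point
  lies strictly above one of the two tangent lines.

  In the triangle of pairs \<open>(s\<^sub>1, s\<^sub>2)\<close> start from the diagonal and enlarge the copy as long as it is
  inscribed. It can leave the closed domain only by hitting one of the other two sides. One leg of the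
  triangle consists of positions touching the second side and the other leg of positions touching
  the third. If no inscribed position touched both, the boundary of the triangle would map to the
  circle with winding number one, although the triangle is contractible.
\<close>

section \<open>Angles and winding numbers\<close>

lemma continuous_angle_exists:
  fixes f :: "'a::real_normed_vector \<Rightarrow> complex"
  assumes "continuous_on S f" "contractible S" "\<And>x. x \<in> S \<Longrightarrow> f x \<noteq> 0"
  obtains \<theta> where "continuous_on S \<theta>" "\<And>x. x \<in> S \<Longrightarrow> sgn (f x) = cis (\<theta> x)"
proof -
  obtain q where q: "continuous_on S q" "\<And>x. x \<in> S \<Longrightarrow> f x = exp (q x)"
    using continuous_logarithm_on_contractible[OF assms] by blast
  show thesis
  proof
    show "continuous_on S (\<lambda>x. Im (q x))" using q(1) by (intro continuous_intros)
    show "sgn (f x) = cis (Im (q x))" if "x \<in> S" for x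
      using q(2)[OF that] by (simp add: exp_eq_polar sgn_mult sgn_of_real)
  qed
qed

lemma cis_add_2pi [simp]: "cis (x + 2 * pi) = cis x" and cis_diff_2pi [simp]: "cis (x - 2 * pi) = cis x"
  by (simp_all flip: cis_mult cis_divide)

lemma cis_eq_imp_abs_diff_ge_1:
  assumes "cis x = cis y" "x \<noteq> y"
  shows "1 \<le> \<bar>x - y\<bar>"
proof -
  have "cis (x - y) = 1" using assms(1) by (simp flip: cis_divide)
  then have "cos (x - y) = 1" by (metis cis.sel(1) one_complex.sel(1))
  then obtain n :: int where n: "x - y = of_int n * 2 * pi" by (auto simp: cos_one_2pi_int)
  then have "n \<noteq> 0" using assms(2) by auto
  then have "1 * 1 \<le> \<bar>real_of_int n\<bar> * (2 * pi)" using pi_gt3 by (intro mult_mono) linarith+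
  then show ?thesis using n by (simp add: abs_mult)
qed

lemma cis_eq_imp_constant_diff:
  fixes \<theta> \<phi> :: "'a::topological_space \<Rightarrow> real"
  assumes "connected S" "continuous_on S \<theta>" "continuous_on S \<phi>"
    and "\<And>x. x \<in> S \<Longrightarrow> cis (\<theta> x) = cis (\<phi> x)" "x \<in> S" "y \<in> S"
  shows "\<theta> x - \<phi> x = \<theta> y - \<phi> y"
proof -
  have "(\<lambda>x. \<theta> x - \<phi> x) constant_on S"
  proof (rule continuous_discrete_range_constant[OF assms(1)])
    show "continuous_on S (\<lambda>x. \<theta> x - \<phi> x)" by (intro continuous_intros assms)
    fix x assume "x \<in> S"
    have "1 \<le> norm (\<theta> y - \<phi> y - (\<theta> x - \<phi> x))" if "y \<in> S" "\<theta> y - \<phi> y \<noteq> \<theta> x - \<phi> x" for y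
    proof -
      have "cis (\<theta> z - \<phi> z) = 1" if "z \<in> S" for z
        unfolding cis_divide[symmetric] using assms(4)[OF that] by simp
      then show ?thesis using cis_eq_imp_abs_diff_ge_1 that \<open>x \<in> S\<close> by (metis real_norm_def)
    qed
    then show "\<exists>e>0. \<forall>y. y \<in> S \<and> \<theta> y - \<phi> y \<noteq> \<theta> x - \<phi> x \<longrightarrow> e \<le> norm (\<theta> y - \<phi> y - (\<theta> x - \<phi> x))"
      using zero_less_one by blast
  qed
  then show ?thesis using assms(5,6) unfolding constant_on_def by metis
qed

lemma sgn_eq_cis_imp_rcis: "sgn z = cis w \<Longrightarrow> z = rcis (norm z) w"
  by (auto simp: rcis_def sgn_eq divide_eq_eq mult.commute split: if_splits)

lemma sgn_eq_cis_imp_Im_rotated: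
  assumes "sgn z = cis w"
  shows "Im (cis (-p) * z) = norm z * sin (w - p)"
proof -
  have "cis (-p) * z = rcis 1 (-p) * rcis (norm z) w"
    using sgn_eq_cis_imp_rcis[OF assms] by (simp add: cis_rcis_eq)
  then show ?thesis unfolding rcis_mult by simp
qed

lemma angle_between:
  assumes "Im (cis (-p) * z) > 0" "Im (cis (-q) * z) < 0" "p < q" "q \<le> p + pi"
  obtains w where "p < w" "w < q" "sgn z = cis w"
proof -
  define y where "y = Arg (cis (-p) * z)"
  have "z \<noteq> 0" using assms(1) by auto
  then have "sgn (cis (-p) * z) = cis y" by (simp add: y_def cis_Arg)
  moreover have "z = cis p * (cis (-p) * z)" by (simp add: cis_mult flip: mult.assoc)
  ultimately have "sgn z = cis p * cis y" by (metis sgn_cis sgn_mult)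
  then have sgn: "sgn z = cis (p + y)" by (simp add: cis_mult)
  have y: "0 < y" "y < pi" using assms(1) Arg_lt_pi unfolding y_def by blast+
  have "sin (p + y - q) < 0"
    using assms(2) unfolding sgn_eq_cis_imp_Im_rotated[OF sgn] by (simp add: mult_less_0_iff)
  then have "p + y < q" using y assms(3,4) sin_ge_zero[of "p + y - q"] by (cases "p + y < q") auto
  then show thesis using that[of "p + y"] y sgn by auto
qed

lemma winding_number_exp_lift:
  assumes "path q" "\<And>x. x \<in> {0..1} \<Longrightarrow> p x - z = exp (q x)"
  shows "winding_number p z = (pathfinish q - pathstart q) / (2 * of_real pi * \<i>)"
proof -
  have "winding_number p z = winding_number (\<lambda>x. p x - z) 0" by (rule winding_number_offset)
  also have "\<dots> = winding_number (exp \<circ> q) 0" by (rule winding_number_cong) (simp add: assms(2))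
  finally show ?thesis using winding_number_compose_exp[OF assms(1)] by simp
qed

lemma winding_number_affine:
  assumes "path p" "z \<notin> path_image p" "a \<noteq> 0"
  shows "winding_number (\<lambda>x. a * p x + b) (a * z + b) = winding_number p z"
proof -
  obtain q where q: "path q" "pathfinish q - pathstart q = 2 * of_real pi * \<i> * winding_number p z"
    "\<And>x. x \<in> {0..1} \<Longrightarrow> p x = z + exp (q x)"
    using winding_number_as_continuous_log[OF assms(1,2)] by blast
  have "winding_number (\<lambda>x. a * p x + b) (a * z + b) =
    (pathfinish (\<lambda>x. q x + Ln a) - pathstart (\<lambda>x. q x + Ln a)) / (2 * of_real pi * \<i>)"
  proof (rule winding_number_exp_lift)
    show "path (\<lambda>x. q x + Ln a)" using q(1) unfolding path_def by (intro continuous_intros)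
    show "a * p x + b - (a * z + b) = exp (q x + Ln a)" if "x \<in> {0..1}" for x
      using q(3)[OF that] assms(3) by (simp add: exp_add algebra_simps)
  qed
  then show ?thesis using q(2) by (simp add: pathfinish_def pathstart_def)
qed

lemma Re_winding_number_eq_angle_diff:
  assumes "path p" "z \<notin> path_image p" "continuous_on {0..1} \<theta>"
    and "\<And>x. x \<in> {0..1} \<Longrightarrow> sgn (p x - z) = cis (\<theta> x)"
  shows "2 * pi * Re (winding_number p z) = \<theta> 1 - \<theta> 0"
proof -
  obtain q where q: "path q" "pathfinish q - pathstart q = 2 * of_real pi * \<i> * winding_number p z"
    "\<And>x. x \<in> {0..1} \<Longrightarrow> p x = z + exp (q x)"
    using winding_number_as_continuous_log[OF assms(1,2)] by blast
  have "Im (q 1) - \<theta> 1 = Im (q 0) - \<theta> 0"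
  proof (rule cis_eq_imp_constant_diff[of "{0..1}" "\<lambda>x. Im (q x)"])
    show "continuous_on {0..1} (\<lambda>x. Im (q x))"
      using q(1) unfolding path_def by (intro continuous_intros)
    show "cis (Im (q x)) = cis (\<theta> x)" if "x \<in> {0..1}" for x
      using assms(4)[OF that] q(3)[OF that] by (simp add: exp_eq_polar sgn_mult sgn_of_real)
  qed (use assms(3) in auto)
  moreover have "Im (q 1 - q 0) = 2 * pi * Re (winding_number p z)"
    using q(2) by (simp add: pathfinish_def pathstart_def)
  ultimately show ?thesis by simp
qed

lemma winding_number_eq_Ln_diff:
  assumes "path p" "w \<noteq> 0" "\<And>x. x \<in> {0..1} \<Longrightarrow> w * (p x - z) \<notin> \<real>\<^sub>\<le>\<^sub>0"
  shows "winding_number p z =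
    (Ln (w * (pathfinish p - z)) - Ln (w * (pathstart p - z))) / (2 * of_real pi * \<i>)"
proof -
  let ?q = "\<lambda>x. Ln (w * (p x - z)) - Ln w"
  have "winding_number p z = (pathfinish ?q - pathstart ?q) / (2 * of_real pi * \<i>)"
  proof (rule winding_number_exp_lift)
    show "path ?q" using assms unfolding path_def by (intro continuous_intros) auto
    show "p x - z = exp (?q x)" if "x \<in> {0..1}" for x
    proof -
      have "w * (p x - z) \<noteq> 0" using assms(3)[OF that] by auto
      then have "p x \<noteq> z" by auto
      then show ?thesis using assms(2) by (simp add: exp_diff)
    qed
  qed
  then show ?thesis by (simp add: pathfinish_def pathstart_def)
qed

text \<open>The point \<open>z - of_real \<sigma> / w\<close> moves towards \<open>z\<close> along the ray on which \<open>w * (x - z)\<close> is negative.\<close>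
lemma winding_number_tendsto_along_slit:
  assumes "path p" "w \<noteq> 0" "pathstart p \<noteq> z" "pathfinish p \<noteq> z"
    and slit: "\<forall>x\<in>path_image p - {z}. w * (x - z) \<notin> \<real>\<^sub>\<le>\<^sub>0"
  shows "((\<lambda>\<sigma>. winding_number p (z - of_real \<sigma> / w)) \<longlongrightarrow>
      (Ln (w * (pathfinish p - z)) - Ln (w * (pathstart p - z))) / (2 * of_real pi * \<i>)) (at_right 0)"
    and "\<forall>\<^sub>F \<sigma> in at_right 0. z - of_real \<sigma> / w \<notin> path_image p"
proof -
  have shift: "w * (x - (z - of_real \<sigma> / w)) = w * (x - z) + of_real \<sigma>" for x \<sigma>
    using assms(2) by (simp add: field_simps)
  have off: "w * (x - (z - of_real \<sigma> / w)) \<notin> \<real>\<^sub>\<le>\<^sub>0" if "\<sigma> > 0" "x \<in> path_image p" for x \<sigma>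
    using slit that unfolding shift
    by (cases "x = z") (auto simp: complex_nonpos_Reals_iff)
  have pos: "\<forall>\<^sub>F \<sigma> in at_right 0. \<sigma> > (0::real)" by (rule eventually_at_right_less)
  then show "\<forall>\<^sub>F \<sigma> in at_right 0. z - of_real \<sigma> / w \<notin> path_image p"
    by eventually_elim (use off in fastforce)
  let ?f = "\<lambda>\<sigma>. (Ln (w * (pathfinish p - z) + of_real \<sigma>) - Ln (w * (pathstart p - z) + of_real \<sigma>))
      / (2 * of_real pi * \<i>)"
  have lim: "((\<lambda>\<sigma>. Ln (w * (x - z) + of_real \<sigma>)) \<longlongrightarrow> Ln (w * (x - z) + of_real 0)) (at_right 0)"
    if "x \<in> path_image p" "x \<noteq> z" for x
    by (intro tendsto_intros) (use slit that in simp)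
  have "(?f \<longlongrightarrow> ?f 0) (at_right 0)"
    by (intro tendsto_intros lim pathstart_in_path_image pathfinish_in_path_image assms) simp
  then show "((\<lambda>\<sigma>. winding_number p (z - of_real \<sigma> / w)) \<longlongrightarrow>
      (Ln (w * (pathfinish p - z)) - Ln (w * (pathstart p - z))) / (2 * of_real pi * \<i>)) (at_right 0)"
  proof (rule Lim_transform_eventually[THEN tendsto_eq_rhs])
    show "\<forall>\<^sub>F \<sigma> in at_right 0. ?f \<sigma> = winding_number p (z - of_real \<sigma> / w)"
      using pos
    proof eventually_elim
      case (elim \<sigma>)
      then show ?case using winding_number_eq_Ln_diff[OF assms(1,2), of "z - of_real \<sigma> / w"] off
        unfolding shift by (simp add: path_image_def)
    qed
  qed simp
qed

section \<open>Periodic Jordan parametrisations\<close>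

lemma jordan_param_periodic:
  fixes k :: int
  assumes "jordan_param g"
  shows "g (t + of_int k) = g t"
proof -
  have nat: "g (t + real n) = g t" for t and n :: nat
  proof (induction n)
    case (Suc n)
    have "g (t + real (Suc n)) = g ((t + real n) + 1)" by (simp add: algebra_simps)
    then show ?case using assms Suc by (simp add: jordan_param_def)
  qed simp
  show ?thesis
  proof (cases "k \<ge> 0")
    case True then show ?thesis using nat[of t "nat k"] by simp
  next
    case False then show ?thesis using nat[of "t + of_int k" "nat (-k)"] by simp
  qed
qed

lemma jordan_param_add_1: "jordan_param g \<Longrightarrow> g (t + 1) = g t"
  by (simp add: jordan_param_def)

lemma jordan_param_continuous: "jordan_param g \<Longrightarrow> continuous_on S g"
  by (auto simp: jordan_param_def intro: continuous_on_subset)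

lemma jordan_param_loop:
  assumes "jordan_param g"
  shows "simple_path g" "path g" "pathfinish g = pathstart g"
  using assms jordan_param_add_1[OF assms, of 0]
  by (auto simp: jordan_param_def simple_path_def pathfinish_def pathstart_def)

lemma jordan_param_inj:
  assumes "jordan_param g" "g x = g y" "x \<in> {a..<a+1}" "y \<in> {a..<a+1}"
  shows "x = y"
proof -
  have frac: "g (frac t) = g t" for t
    using jordan_param_periodic[OF assms(1), of t "- \<lfloor>t\<rfloor>"] by (simp add: frac_def)
  have "loop_free g" using jordan_param_loop(1)[OF assms(1)] by (simp add: simple_path_def)
  then have "frac x = frac y"
    using assms(2) frac_lt_1[of x] frac_lt_1[of y] frac frac_ge_0[of x] frac_ge_0[of y]
    unfolding loop_free_def by (metis atLeastAtMost_iff less_eq_real_def less_irrefl)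
  then have "x - y = of_int (\<lfloor>x\<rfloor> - \<lfloor>y\<rfloor>)" by (simp add: frac_def algebra_simps)
  moreover have "\<bar>x - y\<bar> < 1" using assms(3,4) by auto
  ultimately have "\<bar>\<lfloor>x\<rfloor> - \<lfloor>y\<rfloor>\<bar> < 1" by linarith
  with \<open>x - y = of_int (\<lfloor>x\<rfloor> - \<lfloor>y\<rfloor>)\<close> show ?thesis by simp
qed

lemma jordan_param_shift_eq_shiftpath:
  assumes "jordan_param g"
  shows "(\<lambda>t. g (s + t)) = shiftpath (frac s) g"
proof
  fix t
  have "g (s + t) = g (frac s + t)"
    using jordan_param_periodic[OF assms, of "frac s + t" "\<lfloor>s\<rfloor>"] by (simp add: frac_def algebra_simps)
  then show "g (s + t) = shiftpath (frac s) g t"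
    using jordan_param_add_1[OF assms, of "frac s + t - 1"] by (simp add: shiftpath_def)
qed

lemma jordan_param_affine_shift:
  assumes "jordan_param g" "a \<noteq> 0"
  shows "jordan_param (\<lambda>t. a * g (s + t) + b)" (is ?jordan)
    and "path_image (\<lambda>t. a * g (s + t) + b) = (\<lambda>z. a * z + b) ` path_image g" (is ?image)
    and "z \<notin> path_image g \<Longrightarrow>
      winding_number (\<lambda>t. a * g (s + t) + b) (a * z + b) = winding_number g z"
proof -
  note loop = jordan_param_loop[OF assms(1)]
  have frac: "frac s \<in> {0..1}" using frac_ge_0[of s] frac_lt_1[of s] by simp
  note shift = jordan_param_shift_eq_shiftpath[OF assms(1), of s]
  have simple: "simple_path (\<lambda>t. g (s + t))" and image: "path_image (\<lambda>t. g (s + t)) = path_image g"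
    unfolding shift using simple_path_shiftpath[OF loop(1,3)] path_image_shiftpath[OF _ loop(3)] frac
    by auto
  have "path_image (\<lambda>t. a * g (s + t) + b) = (\<lambda>z. a * z + b) ` path_image (\<lambda>t. g (s + t))"
    by (simp only: path_image_def image_image)
  then show ?image by (simp only: image)
  have "continuous_on UNIV (\<lambda>t. a * g (s + t) + b)"
    by (intro continuous_intros continuous_on_compose2[OF jordan_param_continuous[OF assms(1)]]) auto
  moreover have "simple_path (\<lambda>t. a * g (s + t) + b)"
    using simple assms(2) unfolding simple_path_def path_def loop_free_def
    by (auto intro!: continuous_intros)
  ultimately show ?jordan
    using jordan_param_add_1[OF assms(1)] by (simp add: jordan_param_def flip: add.assoc)
  assume z: "z \<notin> path_image g"
  have "winding_number (\<lambda>t. g (s + t)) z = winding_number g z"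
    unfolding shift by (rule winding_number_shiftpath[OF loop(2) z loop(3) frac])
  then show "winding_number (\<lambda>t. a * g (s + t) + b) (a * z + b) = winding_number g z"
    using winding_number_affine[OF simple_path_imp_path[OF simple] _ assms(2)] z image by simp
qed

lemma jordan_param_image_period:
  assumes "jordan_param g"
  shows "path_image g = g ` {s..s+1}"
proof -
  have "path_image g = (\<lambda>t. g (s + t)) ` {0..1}"
    using jordan_param_affine_shift(2)[OF assms, of 1 s 0] by (simp add: path_image_def)
  also have "\<dots> = g ` ((+) s ` {0..1})" by (simp only: image_image)
  finally show ?thesis by (simp add: add.commute)
qed

lemma path_subpath_continuous:
  fixes g :: "real \<Rightarrow> 'a::real_normed_vector"
  assumes "continuous_on UNIV g"
  shows "path (subpath u v g)"
  unfolding path_def subpath_def by (intro continuous_on_compose2[OF assms] continuous_intros) auto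

lemma jordan_param_winding_number_split:
  assumes "jordan_param g" "u \<le> v" "v \<le> u + 1" "z \<notin> path_image g"
  shows "winding_number g z = winding_number (subpath u v g) z + winding_number (subpath v (u + 1) g) z"
proof -
  define h where "h = (\<lambda>t. g (u + t))"
  have h: "path h" "path_image h = path_image g" "winding_number h z = winding_number g z"
    using jordan_param_affine_shift[OF assms(1), of 1 u 0]
      jordan_param_affine_shift(3)[OF assms(1) _ assms(4), of 1 u 0]
    by (simp_all add: h_def jordan_param_loop(2))
  have "subpath u v g = subpath 0 (v - u) h" "subpath v (u + 1) g = subpath (v - u) 1 h"
    by (auto simp: subpath_def h_def fun_eq_iff algebra_simps)
  then show ?thesis
    using winding_number_subpath_combine[OF h(1), of z 0 "v - u" 1] h assms by simp
qed

lemma jordan_param_not_on_complementary_arc: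
  assumes "jordan_param g" "u < s" "s < v" "v < u + 1"
  shows "g s \<notin> path_image (subpath v (u + 1) g)"
proof -
  have "g x \<noteq> g s" if "x \<in> {v..u + 1}" for x
    using jordan_param_inj[OF assms(1), of x s u] jordan_param_inj[OF assms(1), of u s u]
      jordan_param_add_1[OF assms(1), of u] that assms
    by (cases "x = u + 1") auto
  then show ?thesis using assms by (force simp: path_image_subpath)
qed

lemma jordan_param_winding_number_tendsto_along_slit:
  assumes g: "jordan_param g" and s: "u < s" "s < v" "v < u + 1" and "w \<noteq> 0"
    and slit: "\<forall>x\<in>{u..v} - {s}. w * (g x - g s) \<notin> \<real>\<^sub>\<le>\<^sub>0"
  shows "((\<lambda>\<sigma>. winding_number g (g s - of_real \<sigma> / w)) \<longlongrightarrow>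
      (Ln (w * (g v - g s)) - Ln (w * (g u - g s))) / (2 * of_real pi * \<i>)
      + winding_number (subpath v (u + 1) g) (g s)) (at_right 0)"
    and "\<forall>\<^sub>F \<sigma> in at_right 0. g s - of_real \<sigma> / w \<notin> path_image g"
proof -
  let ?arc = "subpath u v g" and ?rest = "subpath v (u + 1) g"
  let ?z = "\<lambda>\<sigma>. g s - of_real \<sigma> / w"
  note path = path_subpath_continuous[OF jordan_param_continuous[OF g]]
  note off = jordan_param_not_on_complementary_arc[OF g s]
  have "{u..u + 1} = {u..v} \<union> {v..u + 1}" using s by auto
  then have image: "path_image g = path_image ?arc \<union> path_image ?rest"
    using jordan_param_image_period[OF g, of u] s by (simp add: path_image_subpath image_Un)
  have arc_slit: "\<forall>x\<in>path_image ?arc - {g s}. w * (x - g s) \<notin> \<real>\<^sub>\<le>\<^sub>0"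
    using slit s by (auto simp: path_image_subpath)
  have "g u \<noteq> g s" "g v \<noteq> g s"
    using jordan_param_inj[OF g, of u s u] jordan_param_inj[OF g, of v s u] s by auto
  then have arc: "((\<lambda>\<sigma>. winding_number ?arc (?z \<sigma>)) \<longlongrightarrow>
      (Ln (w * (g v - g s)) - Ln (w * (g u - g s))) / (2 * of_real pi * \<i>)) (at_right 0)"
    "\<forall>\<^sub>F \<sigma> in at_right 0. ?z \<sigma> \<notin> path_image ?arc"
    using winding_number_tendsto_along_slit[OF path[of u v] \<open>w \<noteq> 0\<close> _ _ arc_slit] by auto
  have lim_z: "(?z \<longlongrightarrow> g s) (at_right 0)" using \<open>w \<noteq> 0\<close> by (auto intro!: tendsto_eq_intros)
  have "open (- path_image ?rest)" using closed_path_image[OF path] by (rule open_Compl)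
  then have "\<forall>\<^sub>F \<sigma> in at_right 0. ?z \<sigma> \<notin> path_image ?rest"
    using topological_tendstoD[OF lim_z, of "- path_image ?rest"] off by simp
  with arc(2) show ev: "\<forall>\<^sub>F \<sigma> in at_right 0. ?z \<sigma> \<notin> path_image g"
    unfolding image by eventually_elim auto
  have "((\<lambda>\<sigma>. winding_number ?rest (?z \<sigma>)) \<longlongrightarrow> winding_number ?rest (g s)) (at_right 0)"
    using isCont_tendsto_compose[OF continuous_at_winding_number[OF path off] lim_z] .
  from tendsto_add[OF arc(1) this] show "((\<lambda>\<sigma>. winding_number g (?z \<sigma>)) \<longlongrightarrow>
      (Ln (w * (g v - g s)) - Ln (w * (g u - g s))) / (2 * of_real pi * \<i>)
      + winding_number ?rest (g s)) (at_right 0)"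
  proof (rule Lim_transform_eventually)
    show "\<forall>\<^sub>F \<sigma> in at_right 0.
        winding_number ?arc (?z \<sigma>) + winding_number ?rest (?z \<sigma>) = winding_number g (?z \<sigma>)"
      using ev by eventually_elim (use s in \<open>simp add: jordan_param_winding_number_split[OF g, of u v]\<close>)
  qed
qed

lemma Ln_minus_if_Im_pos: "Im z > 0 \<Longrightarrow> Ln (- z) = Ln z - \<i> * pi"
  and Ln_minus_if_Im_neg: "Im z < 0 \<Longrightarrow> Ln (- z) = Ln z + \<i> * pi"
  by (subst Ln_minus; auto)+

lemma winding_number_jump_across_curve:
  assumes g: "jordan_param g" and s: "u < s" "s < v" "v < u + 1" and "w \<noteq> 0"
    and right: "\<forall>x\<in>{u..v} - {s}. Re (w * (g x - g s)) > 0"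
    and cross: "\<forall>x\<in>{u..v} - {s}. Im (w * (g x - g s)) \<noteq> 0"
    and behind: "Im (w * (g u - g s)) < 0" and ahead: "Im (w * (g v - g s)) > 0"
  shows "((\<lambda>\<sigma>. winding_number g (g s - of_real \<sigma> / w) - winding_number g (g s + of_real \<sigma> / w))
      \<longlongrightarrow> 1) (at_right 0)"
    and "\<forall>\<^sub>F \<sigma> in at_right 0. g s - of_real \<sigma> / w \<notin> path_image g \<and> g s + of_real \<sigma> / w \<notin> path_image g"
proof -
  have "- w \<noteq> 0" using \<open>w \<noteq> 0\<close> by simp
  have "w * (g x - g s) \<notin> \<real>\<^sub>\<le>\<^sub>0 \<and> - w * (g x - g s) \<notin> \<real>\<^sub>\<le>\<^sub>0" if "x \<in> {u..v} - {s}" for x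
    using bspec[OF right that] bspec[OF cross that]
    unfolding mult_minus_left complex_nonpos_Reals_iff uminus_complex.sel by linarith
  then have slits: "\<forall>x\<in>{u..v} - {s}. w * (g x - g s) \<notin> \<real>\<^sub>\<le>\<^sub>0" "\<forall>x\<in>{u..v} - {s}. - w * (g x - g s) \<notin> \<real>\<^sub>\<le>\<^sub>0"
    by blast+
  have flip: "g s - of_real \<sigma> / - w = g s + of_real \<sigma> / w" for \<sigma> by simp
  note left_limit = jordan_param_winding_number_tendsto_along_slit[OF g s \<open>w \<noteq> 0\<close> slits(1)]
    and right_limit =
        jordan_param_winding_number_tendsto_along_slit[OF g s \<open>- w \<noteq> 0\<close> slits(2), unfolded flip]
  show "\<forall>\<^sub>F \<sigma> in at_right 0. g s - of_real \<sigma> / w \<notin> path_image g \<and> g s + of_real \<sigma> / w \<notin> path_image g"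
    using left_limit(2) right_limit(2) by eventually_elim simp
  show "((\<lambda>\<sigma>. winding_number g (g s - of_real \<sigma> / w) - winding_number g (g s + of_real \<sigma> / w))
      \<longlongrightarrow> 1) (at_right 0)"
    by (rule tendsto_eq_rhs[OF tendsto_diff[OF left_limit(1) right_limit(1)]])
      (simp only: mult_minus_left Ln_minus_if_Im_pos[OF ahead] Ln_minus_if_Im_neg[OF behind],
       simp add: field_simps)
qed

lemma ccw_left_side_inside:
  assumes g: "jordan_param g" "ccw g" and s: "u < s" "s < v" "v < u + 1"
    and below: "\<And>x. x \<in> {u..v} \<Longrightarrow> x \<noteq> s \<Longrightarrow> Im (cis (-\<eta>) * (g x - g s)) < 0"
    and cross: "\<And>x. x \<in> {u..v} \<Longrightarrow> x \<noteq> s \<Longrightarrow> Re (cis (-\<eta>) * (g x - g s)) \<noteq> 0"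
    and behind: "Re (cis (-\<eta>) * (g u - g s)) < 0" and ahead: "Re (cis (-\<eta>) * (g v - g s)) > 0"
  shows "\<forall>\<^sub>F \<sigma> in at_right 0. g s + cis \<eta> * (\<i> * of_real \<sigma>) \<in> inside (path_image g)"
proof -
  define w where "w = \<i> * cis (-\<eta>)"
  have w: "w \<noteq> 0" "Re (w * z) = - Im (cis (-\<eta>) * z)" "Im (w * z) = Re (cis (-\<eta>) * z)" for z
    by (simp_all add: w_def)
  have slit: "of_real \<sigma> / w = - (cis \<eta> * (\<i> * of_real \<sigma>))" for \<sigma>
    by (simp add: w_def divide_inverse mult_ac)
  have "((\<lambda>\<sigma>. winding_number g (g s - of_real \<sigma> / w) - winding_number g (g s + of_real \<sigma> / w))
      \<longlongrightarrow> 1) (at_right 0)"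
    and avoid:
      "\<forall>\<^sub>F \<sigma> in at_right 0. g s - of_real \<sigma> / w \<notin> path_image g \<and> g s + of_real \<sigma> / w \<notin> path_image g"
    by (rule winding_number_jump_across_curve[OF g(1) s w(1)];
        unfold w(2,3); use below cross behind ahead in force)+
  then have "\<forall>\<^sub>F \<sigma> in at_right 0.
      dist (winding_number g (g s - of_real \<sigma> / w) - winding_number g (g s + of_real \<sigma> / w)) 1 < 1"
    by (intro tendstoD) auto
  with avoid show ?thesis
  proof eventually_elim
    case (elim \<sigma>)
    note outside = winding_number_zero_in_outside[OF jordan_param_loop(2,3)[OF g(1)]]
    have "winding_number g (g s + of_real \<sigma> / w) = 0 \<or> winding_number g (g s + of_real \<sigma> / w) = 1"
      using elim(1) outside g(2) unfolding ccw_def by (metis ComplI UnE inside_Un_outside)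
    then have "winding_number g (g s - of_real \<sigma> / w) \<noteq> 0" using elim(2) by (auto simp: dist_norm)
    then have "g s - of_real \<sigma> / w \<in> inside (path_image g)"
      using elim(1) outside inside_Un_outside[of "path_image g"] by blast
    then show ?case by (simp add: slit)
  qed
qed

section \<open>Topological tools\<close>

lemma continuous_on_from_open_part:
  assumes "openin (top_of_set S) U" "continuous_on U f"
    and "\<And>x. x \<in> S - U \<Longrightarrow> continuous (at x within S) f"
  shows "continuous_on S f"
  unfolding continuous_on_eq_continuous_within
proof
  fix x assume "x \<in> S"
  obtain V where V: "open V" "U = S \<inter> V" using assms(1) by (auto simp: openin_open)
  show "continuous (at x within S) f"
  proof (cases "x \<in> U")
    case True
    then have "at x within S = at x within U" using V by (intro at_within_nhd[of x V]) auto
    then show ?thesis using assms(2) True by (simp add: continuous_on_eq_continuous_within)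
  qed (use assms(3) \<open>x \<in> S\<close> in blast)
qed

lemma openin_if_eventually_within:
  fixes U :: "'a::metric_space set"
  assumes "U \<subseteq> S" "\<And>x. x \<in> U \<Longrightarrow> \<forall>\<^sub>F y in at x within S. y \<in> U"
  shows "openin (top_of_set S) U"
proof -
  have "\<exists>e>0. ball x e \<inter> S \<subseteq> U" if x: "x \<in> U" for x
  proof -
    obtain e where "e > 0" "\<And>y. y \<in> S \<Longrightarrow> y \<noteq> x \<Longrightarrow> dist y x < e \<Longrightarrow> y \<in> U"
      using assms(2)[OF x] unfolding eventually_at by blast
    then show ?thesis using x by (intro exI[of _ e]) (metis Int_iff dist_commute mem_ball subsetI)
  qed
  then show ?thesis using assms(1) by (simp add: openin_contains_ball)
qed

lemma upcrossing_zero_unique: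
  fixes f :: "real \<Rightarrow> real"
  assumes cont: "continuous_on {l..u} f"
    and up: "\<And>x. x \<in> {l..u} \<Longrightarrow> f x = 0 \<Longrightarrow> (\<forall>\<^sub>F y in at_right x. f y > 0) \<and> (\<forall>\<^sub>F y in at_left x. f y < 0)"
    and zeros: "x \<in> {l..u}" "f x = 0" "y \<in> {l..u}" "f y = 0"
  shows "x = y"
proof -
  have False if xy: "x \<in> {l..u}" "f x = 0" "y \<in> {l..u}" "f y = 0" "x < y" for x y
  proof -
    obtain b where "b > x" "\<And>w. x < w \<Longrightarrow> w < b \<Longrightarrow> f w > 0"
      using up[OF xy(1,2)] unfolding eventually_at_right_field by auto
    moreover obtain x' where "x < x'" "x' < min b y" using dense[of x "min b y"] \<open>b > x\<close> xy by auto
    ultimately have x': "x < x'" "x' < y" "f x' > 0" by auto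
    define Z where "Z = {x'..y} \<inter> f -` {0}"
    have sub: "{x'..y} \<subseteq> {l..u}" using x' xy by auto
    have "closed Z"
      unfolding Z_def by (rule continuous_closed_preimage[OF continuous_on_subset[OF cont sub]]) auto
    then have "compact Z" using compact_Int_closed[of "{x'..y}" Z] by (simp add: Z_def)
    moreover have "y \<in> Z" using x' xy by (simp add: Z_def)
    ultimately obtain z where z: "z \<in> Z" "\<And>w. w \<in> Z \<Longrightarrow> z \<le> w" using compact_attains_inf[of Z] by auto
    then have "x' < z" "f z = 0" "z \<in> {l..u}" using x' sub by (auto simp: Z_def less_le)
    then obtain b where "b < z" "\<And>w. b < w \<Longrightarrow> w < z \<Longrightarrow> f w < 0"
      using up[of z] unfolding eventually_at_left_field by auto
    moreover obtain w where "max b x' < w" "w < z" using dense[of "max b x'" z] \<open>b < z\<close> \<open>x' < z\<close> by auto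
    ultimately have w: "x' < w" "w < z" "f w < 0" by auto
    have "continuous_on {x'..w} f"
      using cont by (rule continuous_on_subset) (use w z(1) sub in \<open>auto simp: Z_def\<close>)
    then obtain v where "x' \<le> v" "v \<le> w" "f v = 0" using IVT2'[of f w 0 x'] w x' by auto
    then show False using z(2)[of v] w z(1) by (auto simp: Z_def)
  qed
  then show ?thesis using zeros by (metis linorder_less_linear)
qed

lemma continuous_on_cis_sign_change:
  fixes f :: "'a::topological_space \<Rightarrow> real"
  assumes G: "closedin (top_of_set D) G" and exit: "openin (top_of_set D) (G - E)"
    and f: "continuous_on D f" "\<And>x. x \<in> G \<inter> E \<Longrightarrow> f x = 0 \<or> f x = 1"
  shows "continuous_on D (\<lambda>x. if x \<in> G then cis (pi * f x) else cis (- (pi * f x)))"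
proof -
  let ?out = "D - (G - E)"
  have sub: "G \<subseteq> D" using G by (rule closedin_imp_subset)
  then have D: "G \<union> ?out = D" by blast
  have "continuous_on (G \<union> ?out) (\<lambda>x. if x \<in> G then cis (pi * f x) else cis (- (pi * f x)))"
  proof (rule continuous_on_cases_local)
    show "closedin (top_of_set (G \<union> ?out)) G" "closedin (top_of_set (G \<union> ?out)) ?out"
      unfolding D using G closedin_diff[OF closedin_topspace exit] by simp_all
    show "continuous_on G (\<lambda>x. cis (pi * f x))" "continuous_on ?out (\<lambda>x. cis (- (pi * f x)))"
      using sub by (auto intro!: continuous_intros continuous_on_subset[OF f(1)])
    fix x assume "x \<in> G \<and> x \<notin> G \<or> x \<in> ?out \<and> x \<in> G"
    then have "f x = 0 \<or> f x = 1" using f(2) by blast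
    then show "cis (pi * f x) = cis (- (pi * f x))" by (auto simp: complex_eq_iff)
  qed
  then show ?thesis unfolding D .
qed

lemma angle_with_sign_change:
  fixes f :: "'a::real_normed_vector \<Rightarrow> real"
  assumes "contractible D" and G: "closedin (top_of_set D) G" and exit: "openin (top_of_set D) (G - E)"
    and f: "continuous_on D f" "\<And>x. x \<in> G \<inter> E \<Longrightarrow> f x = 0 \<or> f x = 1"
  obtains \<theta> where "continuous_on D \<theta>" "\<And>x. x \<in> G \<Longrightarrow> cis (\<theta> x) = cis (pi * f x)"
    "\<And>x. x \<in> D - (G - E) \<Longrightarrow> cis (\<theta> x) = cis (- (pi * f x))"
proof -
  define h where "h x = (if x \<in> G then cis (pi * f x) else cis (- (pi * f x)))" for x
  have "continuous_on D h"
    unfolding h_def by (rule continuous_on_cis_sign_change[OF G exit f])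
  moreover have "h x \<noteq> 0" for x by (simp add: h_def)
  ultimately obtain \<theta> where \<theta>: "continuous_on D \<theta>" "\<And>x. x \<in> D \<Longrightarrow> sgn (h x) = cis (\<theta> x)"
    using continuous_angle_exists[OF _ \<open>contractible D\<close>] by blast
  have angle: "cis (\<theta> x) = h x" if "x \<in> D" for x
    using \<theta>(2)[OF that] by (simp add: h_def split: if_splits)
  have "cis (\<theta> x) = cis (pi * f x)" if "x \<in> G" for x
    using angle[of x] closedin_imp_subset[OF G] that by (auto simp: h_def)
  moreover have "cis (\<theta> x) = cis (- (pi * f x))" if x: "x \<in> D - (G - E)" for x
  proof -
    have "x \<in> G \<Longrightarrow> f x = 0 \<or> f x = 1" using f(2) x by blast
    then have "h x = cis (- (pi * f x))" by (auto simp: h_def complex_eq_iff)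
    then show ?thesis using angle x by simp
  qed
  ultimately show thesis using that \<theta>(1) by blast
qed

text \<open>Otherwise a Urysohn function \<open>f\<close> separates \<open>G \<inter> A\<close> from \<open>G \<inter> B\<close>, and \<open>cis (\<plusminus> pi * f)\<close>,
  with the sign changing across the boundary of \<open>G\<close>, is a continuous map to the circle that winds
  once around along \<open>L \<union> X \<union> Y\<close>.\<close>
lemma exit_sets_meet:
  fixes D :: "'a::euclidean_space set"
  assumes "contractible D" and G: "closedin (top_of_set D) G"
    and A: "closedin (top_of_set D) A" and B: "closedin (top_of_set D) B"
    and exit: "openin (top_of_set D) (G - (A \<union> B))"
    and L: "connected L" "L \<subseteq> G"
    and X: "connected X" "X \<subseteq> A" "X \<inter> L \<noteq> {}" and Y: "connected Y" "Y \<subseteq> B" "Y \<inter> L \<noteq> {}"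
    and "X \<inter> Y \<noteq> {}"
  shows "G \<inter> A \<inter> B \<noteq> {}"
proof
  assume "G \<inter> A \<inter> B = {}"
  then have "(G \<inter> A) \<inter> (G \<inter> B) = {}" by blast
  then obtain f :: "'a \<Rightarrow> real" where f: "continuous_on D f"
    "\<And>x. x \<in> G \<inter> A \<Longrightarrow> f x = 0" "\<And>x. x \<in> G \<inter> B \<Longrightarrow> f x = 1"
    using Urysohn_local[OF closedin_Int[OF G A] closedin_Int[OF G B], of 0 "1::real"] by metis
  then have ends: "f x = 0 \<or> f x = 1" if "x \<in> G \<inter> (A \<union> B)" for x using that by blast
  obtain \<theta> where \<theta>: "continuous_on D \<theta>" "\<And>x. x \<in> G \<Longrightarrow> cis (\<theta> x) = cis (pi * f x)"
    "\<And>x. x \<in> D - (G - (A \<union> B)) \<Longrightarrow> cis (\<theta> x) = cis (- (pi * f x))"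
    using angle_with_sign_change[OF assms(1) G exit f(1) ends] by metis
  have sub: "G \<subseteq> D" "A \<subseteq> D" "B \<subseteq> D" using G A B by (auto dest: closedin_imp_subset)
  have f\<theta>: "continuous_on S f" "continuous_on S \<theta>" if "S \<subseteq> D" for S
    using f(1) \<theta>(1) that by (auto intro: continuous_on_subset)
  have exit_set: "\<theta> x - - (pi * f x) = \<theta> y - - (pi * f y)"
    if S: "connected S" "S \<subseteq> A \<or> S \<subseteq> B" "x \<in> S" "y \<in> S" for S x y
  proof (rule cis_eq_imp_constant_diff[OF S(1) _ _ \<theta>(3)])
    have "S \<subseteq> D" using S(2) sub by blast
    then show "continuous_on S \<theta>" "continuous_on S (\<lambda>x. - (pi * f x))"
      by (auto intro!: continuous_intros f\<theta>)
    show "z \<in> D - (G - (A \<union> B))" if "z \<in> S" for z using S(2) that \<open>S \<subseteq> D\<close> by blast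
  qed (use S in simp_all)
  have inside: "\<theta> x - pi * f x = \<theta> y - pi * f y" if "x \<in> L" "y \<in> L" for x y
    by (rule cis_eq_imp_constant_diff[OF L(1) _ _ \<theta>(2)])
      (use that L sub in \<open>auto intro!: continuous_intros f\<theta>\<close>)
  obtain x y p where x: "x \<in> X" "x \<in> L" and y: "y \<in> Y" "y \<in> L" and p: "p \<in> X" "p \<in> Y"
    using X(3) Y(3) \<open>X \<inter> Y \<noteq> {}\<close> by blast
  have "\<theta> x - - (pi * f x) = \<theta> p - - (pi * f p)" using exit_set[OF X(1) _ x(1) p(1)] X(2) by blast
  moreover have "\<theta> p - - (pi * f p) = \<theta> y - - (pi * f y)"
    using exit_set[OF Y(1) _ p(2) y(1)] Y(2) by blast
  moreover have "f x = 0" "f y = 1" using f(2,3) x y X(2) Y(2) L(2) by blast+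
  ultimately show False using inside[OF x(2) y(2)] by simp
qed

section \<open>Arcs with a tangent angle\<close>

lemma angle_has_real_derivative:
  fixes f :: "real \<Rightarrow> complex"
  assumes "(f has_vector_derivative f') (at t)" "isCont \<theta> t" "\<forall>\<^sub>F x in nhds t. sgn (f x) = cis (\<theta> x)"
  shows "(\<theta> has_real_derivative Im (f' / f t)) (at t)"
proof -
  have angle: "sgn (f t) = cis (\<theta> t)" using assms(3) by (rule eventually_nhds_x_imp_x)
  then have "f t \<noteq> 0" by auto
  have "\<forall>\<^sub>F x in nhds t. dist (\<theta> x) (\<theta> t) < pi"
    using assms(2) unfolding isCont_def tendsto_at_iff_tendsto_nhds by (rule tendstoD) simp
  with assms(3) have eq: "\<forall>\<^sub>F x in nhds t. \<theta> x = \<theta> t + Im (Ln (f x / f t))"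
  proof eventually_elim
    case (elim x)
    have "sgn (f x / f t) = cis (\<theta> x - \<theta> t)"
      using elim(1) angle by (simp add: divide_inverse sgn_mult sgn_inverse flip: cis_divide)
    then have "Arg (f x / f t) = \<theta> x - \<theta> t"
      by (rule cis_Arg_unique) (use elim(2) in \<open>auto simp: dist_real_def\<close>)
    moreover have "f x / f t \<noteq> 0" using elim(1) \<open>f t \<noteq> 0\<close> by auto
    ultimately show ?case by (simp add: Arg_eq_Im_Ln)
  qed
  have "((\<lambda>x. Ln (f x / f t)) has_vector_derivative f' / f t * 1) (at t)"
  proof (rule field_vector_diff_chain_at[of "\<lambda>x. f x / f t" _ _ Ln, unfolded o_def])
    show "((\<lambda>x. f x / f t) has_vector_derivative f' / f t) (at t)"
      by (rule has_vector_derivative_divide[OF assms(1)])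
    show "(Ln has_field_derivative 1) (at (f t / f t))"
      using has_field_derivative_Ln[of 1] \<open>f t \<noteq> 0\<close> by simp
  qed
  then have "((\<lambda>x. \<theta> t + Im (Ln (f x / f t))) has_vector_derivative 0 + Im (f' / f t * 1)) (at t)"
    by (intro has_vector_derivative_add has_vector_derivative_const
        bounded_linear.has_vector_derivative[OF bounded_linear_Im])
  then have "((\<lambda>x. \<theta> t + Im (Ln (f x / f t))) has_real_derivative Im (f' / f t)) (at t)"
    by (simp add: has_real_derivative_iff_has_vector_derivative)
  then show ?thesis using DERIV_cong_ev[OF refl eq refl] by blast
qed

lemma continuous_angle_on_closed_interval:
  fixes f :: "real \<Rightarrow> complex"
  assumes "a < b" "continuous_on {a<..<b} f" "\<And>t. t \<in> {a<..<b} \<Longrightarrow> f t \<noteq> 0"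
    and v: "((\<lambda>t. sgn (f t)) \<longlongrightarrow> v) (at_right a)" "norm v = 1"
    and w: "((\<lambda>t. sgn (f t)) \<longlongrightarrow> w) (at_left b)" "norm w = 1"
  obtains \<theta> where "continuous_on {a..b} \<theta>" "cis (\<theta> a) = v" "cis (\<theta> b) = w"
    "\<And>t. t \<in> {a<..<b} \<Longrightarrow> sgn (f t) = cis (\<theta> t)"
proof -
  define \<tau> where "\<tau> t = (if t \<le> a then v else if t \<ge> b then w else sgn (f t))" for t
  have "continuous_on {a..b} \<tau>"
  proof (rule continuous_on_IccI)
    have "\<forall>\<^sub>F t in at_right a. sgn (f t) = \<tau> t"
      unfolding eventually_at_right_field using \<open>a < b\<close> by (intro exI[of _ b]) (auto simp: \<tau>_def)
    then show "(\<tau> \<longlongrightarrow> \<tau> a) (at_right a)"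
      using Lim_transform_eventually[OF v(1)] by (simp add: \<tau>_def)
    have "\<forall>\<^sub>F t in at_left b. sgn (f t) = \<tau> t"
      unfolding eventually_at_left_field using \<open>a < b\<close> by (intro exI[of _ a]) (auto simp: \<tau>_def)
    then show "(\<tau> \<longlongrightarrow> \<tau> b) (at_left b)"
      using Lim_transform_eventually[OF w(1)] \<open>a < b\<close> by (simp add: \<tau>_def)
    fix x assume x: "a < x" "x < b"
    have "continuous_on {a<..<b} (\<lambda>t. sgn (f t))"
      using assms(2,3) by (auto intro!: continuous_on_sgn)
    then have "continuous_on {a<..<b} \<tau>"
      by (rule continuous_on_eq) (auto simp: \<tau>_def)
    then show "\<tau> \<midarrow>x\<rightarrow> \<tau> x"
      using x by (simp add: continuous_on_eq_continuous_at isCont_def)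
  qed (fact \<open>a < b\<close>)
  moreover have norm: "norm (\<tau> t) = 1" if "t \<in> {a..b}" for t
    using that v(2) w(2) assms(3)[of t] by (auto simp: \<tau>_def norm_sgn)
  ultimately obtain \<theta> where \<theta>: "continuous_on {a..b} \<theta>" "\<And>t. t \<in> {a..b} \<Longrightarrow> sgn (\<tau> t) = cis (\<theta> t)"
    using continuous_angle_exists[of "{a..b}" \<tau>] convex_imp_contractible[OF convex_real_interval(5)]
    by (metis norm_zero zero_neq_one)
  have "\<tau> t = cis (\<theta> t)" if "t \<in> {a..b}" for t
    using \<theta>(2)[OF that] norm[OF that] by (simp add: sgn_eq)
  from this[of a] this[of b] have "cis (\<theta> a) = v" "cis (\<theta> b) = w"
    using \<open>a < b\<close> by (auto simp: \<tau>_def)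
  moreover have "sgn (f t) = cis (\<theta> t)" if "t \<in> {a<..<b}" for t
    using \<open>\<And>t. t \<in> {a..b} \<Longrightarrow> \<tau> t = cis (\<theta> t)\<close>[of t] that by (auto simp: \<tau>_def)
  ultimately show thesis using that \<theta>(1) by blast
qed

text \<open>If all tangents point between the directions \<open>e\<close> and \<open>e + pi\<close>, so do the secants. This is the only
  trace of the differentiability of \<open>c\<close>; in the applications \<open>\<theta>\<close> is strictly monotone.\<close>
locale turning_arc =
  fixes c :: "real \<Rightarrow> complex" and \<theta> :: "real \<Rightarrow> real" and a b :: real
  assumes a_less_b: "a < b"
    and continuous_curve: "continuous_on {a..b} c"
    and continuous_angle: "continuous_on {a..b} \<theta>"
    and secant_left: "\<lbrakk>a \<le> s; s < t; t \<le> b; \<theta> s \<in> {e..e + pi}; \<theta> t \<in> {e..e + pi}\<rbrakk>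
      \<Longrightarrow> Im (cis (-e) * (c t - c s)) > 0"
begin

lemma secant_right:
  assumes "a \<le> s" "s < t" "t \<le> b" "\<theta> s \<in> {e - pi..e}" "\<theta> t \<in> {e - pi..e}"
  shows "Im (cis (-e) * (c t - c s)) < 0"
proof -
  have "Im (cis (-(e - pi)) * (c t - c s)) > 0" using assms by (intro secant_left) auto
  moreover have "cis (-(e - pi)) = - cis (-e)" by (simp add: complex_eq_iff)
  ultimately show ?thesis by simp
qed

lemma secant_angle:
  assumes "a \<le> s" "s < t" "t \<le> b" "\<theta> s \<noteq> \<theta> t" "\<bar>\<theta> t - \<theta> s\<bar> \<le> pi"
  obtains w where "min (\<theta> s) (\<theta> t) < w" "w < max (\<theta> s) (\<theta> t)" "sgn (c t - c s) = cis w"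
proof (rule angle_between)
  show "Im (cis (- min (\<theta> s) (\<theta> t)) * (c t - c s)) > 0" using assms by (intro secant_left) auto
  show "Im (cis (- max (\<theta> s) (\<theta> t)) * (c t - c s)) < 0" using assms by (intro secant_right) auto
qed (use assms in auto)

lemma secant_left_cong:
  assumes "a \<le> s" "s < t" "t \<le> b" "\<theta> s \<in> {d..d + pi}" "\<theta> t \<in> {d..d + pi}" "cis d = cis e"
  shows "Im (cis (-e) * (c t - c s)) > 0"
  using secant_left[OF assms(1-5)] assms(6) by (simp only: cis_inverse[symmetric])

lemma secant_right_cong:
  assumes "a \<le> s" "s < t" "t \<le> b" "\<theta> s \<in> {d - pi..d}" "\<theta> t \<in> {d - pi..d}" "cis d = cis e"
  shows "Im (cis (-e) * (c t - c s)) < 0"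
  using secant_right[OF assms(1-5)] assms(6) by (simp only: cis_inverse[symmetric])

definition height :: "real \<Rightarrow> complex \<Rightarrow> real" where
  "height s z = Im (cis (- \<theta> s) * (z - c s))"

lemma height_diff: "height s z - height s w = Im (cis (- \<theta> s) * (z - w))"
  by (simp add: height_def algebra_simps)

lemma height_base [simp]: "height s (c s) = 0"
  by (simp add: height_def)

lemma rotate_shift:
  "turning_arc (\<lambda>x. cis \<eta> * c (x0 + x) + w) (\<lambda>x. \<theta> (x0 + x) + \<eta>) (a - x0) (b - x0)"
proof
  show "a - x0 < b - x0" using a_less_b by simp
  show "continuous_on {a - x0..b - x0} (\<lambda>x. cis \<eta> * c (x0 + x) + w)"
    "continuous_on {a - x0..b - x0} (\<lambda>x. \<theta> (x0 + x) + \<eta>)"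
    by (intro continuous_intros continuous_on_compose2[OF continuous_curve]
        continuous_on_compose2[OF continuous_angle]; auto)+
  fix s t e assume st: "a - x0 \<le> s" "s < t" "t \<le> b - x0"
    and angles: "\<theta> (x0 + s) + \<eta> \<in> {e..e + pi}" "\<theta> (x0 + t) + \<eta> \<in> {e..e + pi}"
  have "Im (cis (-(e - \<eta>)) * (c (x0 + t) - c (x0 + s))) > 0"
    using st angles by (intro secant_left) auto
  moreover have "cis (-(e - \<eta>)) = cis (-e) * cis \<eta>" by (simp add: cis_mult)
  moreover have "cis (-e) * (cis \<eta> * c (x0 + t) + w - (cis \<eta> * c (x0 + s) + w)) =
      cis (-e) * cis \<eta> * (c (x0 + t) - c (x0 + s))" by (simp add: algebra_simps)
  ultimately show "Im (cis (-e) * (cis \<eta> * c (x0 + t) + w - (cis \<eta> * c (x0 + s) + w))) > 0"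
    by (simp only:)
qed

lemma reparametrize_by_angle:
  assumes "strict_mono_on {a..b} \<theta>"
  obtains u where "turning_arc (c \<circ> u) (\<lambda>p. p) (\<theta> a) (\<theta> b)"
    "u ` {\<theta> a..\<theta> b} = {a..b}" "\<And>x. x \<in> {a..b} \<Longrightarrow> u (\<theta> x) = x"
proof -
  have inj: "inj_on \<theta> {a..b}" using assms by (rule strict_mono_on_imp_inj_on)
  have image: "\<theta> ` {a..b} = {\<theta> a..\<theta> b}"
  proof
    show "\<theta> ` {a..b} \<subseteq> {\<theta> a..\<theta> b}"
      using a_less_b strict_mono_on_leD[OF assms] by fastforce
    show "{\<theta> a..\<theta> b} \<subseteq> \<theta> ` {a..b}"
      using a_less_b IVT'[of \<theta> a _ b] continuous_angle by fastforce
  qed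
  define u where "u = inv_into {a..b} \<theta>"
  have u: "u p \<in> {a..b}" "\<theta> (u p) = p" if "p \<in> {\<theta> a..\<theta> b}" for p
    using that unfolding image[symmetric] u_def by (rule inv_into_into, rule f_inv_into_f)
  have inverse: "u (\<theta> x) = x" if "x \<in> {a..b}" for x using that inj by (simp add: u_def)
  then have image_u: "u ` {\<theta> a..\<theta> b} = {a..b}" unfolding image[symmetric] by (force simp: image_image)
  have "turning_arc (c \<circ> u) (\<lambda>p. p) (\<theta> a) (\<theta> b)"
  proof
    show "\<theta> a < \<theta> b" using a_less_b by (intro strict_mono_onD[OF assms]) auto
    have "continuous_on {\<theta> a..\<theta> b} u"
      using continuous_on_inv[OF continuous_angle compact_Icc, of u] inverse image by auto
    then show "continuous_on {\<theta> a..\<theta> b} (c \<circ> u)"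
      using continuous_curve by (intro continuous_on_compose) (simp_all only: image_u)
    show "Im (cis (-e) * ((c \<circ> u) q - (c \<circ> u) p)) > 0"
      if "\<theta> a \<le> p" "p < q" "q \<le> \<theta> b" "p \<in> {e..e + pi}" "q \<in> {e..e + pi}" for p q e
    proof -
      have "p \<in> {\<theta> a..\<theta> b}" "q \<in> {\<theta> a..\<theta> b}" using that by auto
      note up = u[OF this(1)] and uq = u[OF this(2)]
      have "u p < u q" using strict_mono_on_less[OF assms up(1) uq(1)] up uq that(2) by simp
      then show ?thesis unfolding o_apply using up uq that by (intro secant_left) auto
    qed
  qed (rule continuous_on_id)
  then show thesis using that image_u inverse by blast
qed

end

lemma turning_arc_if_tangent_angle:
  assumes "a < b" and c: "continuous_on {a..b} c" and \<theta>: "continuous_on {a..b} \<theta>"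
    and der: "\<And>t. t \<in> {a<..<b} \<Longrightarrow> (c has_vector_derivative c' t) (at t)"
    and angle: "\<And>t. t \<in> {a<..<b} \<Longrightarrow> sgn (c' t) = cis (\<theta> t)"
    and mono: "strict_mono_on {a..b} \<theta> \<or> strict_antimono_on {a..b} \<theta>"
  shows "turning_arc c \<theta> a b"
proof
  fix s t e assume st: "a \<le> s" "s < t" "t \<le> b" "\<theta> s \<in> {e..e + pi}" "\<theta> t \<in> {e..e + pi}"
  have "Im (cis (-e) * c s) < Im (cis (-e) * c t)"
  proof (rule DERIV_pos_imp_increasing_open[OF st(2)])
    fix x assume x: "s < x" "x < t"
    have "((\<lambda>x. Im (cis (-e) * c x)) has_vector_derivative Im (cis (-e) * c' x)) (at x)"
      using x st by (intro bounded_linear.has_vector_derivative[OF bounded_linear_Im]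
          has_vector_derivative_mult_right der) auto
    moreover have "Im (cis (-e) * c' x) > 0"
    proof -
      have "sgn (c' x) = cis (\<theta> x)" using angle x st by auto
      moreover have "c' x \<noteq> 0" using calculation by auto
      moreover have "e < \<theta> x \<and> \<theta> x < e + pi"
        using mono monotone_onD[of "{a..b}" _ _ \<theta> s x] monotone_onD[of "{a..b}" _ _ \<theta> x t] x st by force
      ultimately show ?thesis unfolding sgn_eq_cis_imp_Im_rotated[OF \<open>sgn (c' x) = cis (\<theta> x)\<close>]
        by (simp add: sin_gt_zero)
    qed
    ultimately show "\<exists>d. ((\<lambda>x. Im (cis (-e) * c x)) has_real_derivative d) (at x) \<and> 0 < d"
      by (auto simp: has_real_derivative_iff_has_vector_derivative)
  next
    show "continuous_on {s..t} (\<lambda>x. Im (cis (-e) * c x))"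
      by (intro continuous_intros continuous_on_subset[OF c]) (use st in auto)
  qed
  then show "Im (cis (-e) * (c t - c s)) > 0" by (simp add: algebra_simps)
qed (use assms in auto)

lemma smooth_regular_onD:
  assumes "smooth_regular_on g S" "t \<in> S"
  shows "(g has_vector_derivative vd_iter 1 g t) (at t)"
    "(vd_iter 1 g has_vector_derivative vd_iter 2 g t) (at t)" "vd_iter 1 g t \<noteq> 0"
proof -
  have der: "(vd_iter n g has_vector_derivative vd_iter (Suc n) g t) (at t)" for n
    using assms by (auto simp: smooth_regular_on_def)
  show "(g has_vector_derivative vd_iter 1 g t) (at t)" using der[of 0] by simp
  show "(vd_iter 1 g has_vector_derivative vd_iter 2 g t) (at t)"
    using der[of 1] by (simp add: numeral_2_eq_2)
  show "vd_iter 1 g t \<noteq> 0" using assms by (auto simp: smooth_regular_on_def)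
qed

lemma smooth_regular_arc_tangent_angle:
  assumes smooth: "smooth_regular_on g S" and "{a<..<b} \<subseteq> S" "a < b"
    and v: "((\<lambda>t. sgn (vd_iter 1 g t)) \<longlongrightarrow> v) (at_right a)" "norm v = 1"
    and w: "((\<lambda>t. sgn (vd_iter 1 g t)) \<longlongrightarrow> w) (at_left b)" "norm w = 1"
  obtains \<theta> where "continuous_on {a..b} \<theta>" "cis (\<theta> a) = v" "cis (\<theta> b) = w"
    "\<And>t. t \<in> {a<..<b} \<Longrightarrow> sgn (vd_iter 1 g t) = cis (\<theta> t)"
    "\<And>t. t \<in> {a<..<b} \<Longrightarrow> (\<theta> has_real_derivative curvature g t * norm (vd_iter 1 g t)) (at t)"
proof -
  note D = smooth_regular_onD[OF smooth subsetD[OF assms(2)]]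
  have "continuous_on {a<..<b} (vd_iter 1 g)"
    using D(2) has_vector_derivative_continuous by (intro continuous_at_imp_continuous_on) blast
  from continuous_angle_on_closed_interval[OF \<open>a < b\<close> this D(3) v w]
  obtain \<theta> where \<theta>: "continuous_on {a..b} \<theta>" "cis (\<theta> a) = v" "cis (\<theta> b) = w"
    "\<And>t. t \<in> {a<..<b} \<Longrightarrow> sgn (vd_iter 1 g t) = cis (\<theta> t)" by blast
  have "(\<theta> has_real_derivative curvature g t * norm (vd_iter 1 g t)) (at t)" if t: "t \<in> {a<..<b}" for t
  proof -
    have "(\<theta> has_real_derivative Im (vd_iter 2 g t / vd_iter 1 g t)) (at t)"
    proof (rule angle_has_real_derivative[OF D(2)[OF t]])
      show "isCont \<theta> t" using \<theta>(1) t by (simp add: continuous_on_interior)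
      show "\<forall>\<^sub>F x in nhds t. sgn (vd_iter 1 g x) = cis (\<theta> x)"
        using eventually_nhds_in_open[OF open_greaterThanLessThan t] by eventually_elim (rule \<theta>(4))
    qed
    moreover have "Im (vd_iter 2 g t / vd_iter 1 g t) = curvature g t * norm (vd_iter 1 g t)"
      using D(3)[OF t] by (subst complex_div_cnj)
        (simp add: curvature_def Im_divide_of_real mult.commute power2_eq_square power3_eq_cube
          flip: of_real_power)
    ultimately show ?thesis by simp
  qed
  with \<theta> show thesis using that by blast
qed

lemma cuspD:
  assumes "cusp g t v"
  shows "norm v = 1" "((\<lambda>x. sgn (vd_iter 1 g x)) \<longlongrightarrow> v) (at_right t)"
    "((\<lambda>x. sgn (vd_iter 1 g x)) \<longlongrightarrow> - v) (at_left t)"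
  using assms unfolding cusp_def sgn_eq by auto

section \<open>Total turning of a loop with one inward cusp\<close>

lemma filterlim_one_minus_at_left: "filterlim (\<lambda>\<epsilon>. 1 - \<epsilon>) (at_left 1) (at_right (0::real))"
proof -
  have "((\<lambda>\<epsilon>::real. 1 - \<epsilon>) \<longlongrightarrow> 1) (at_right 0)" by (auto intro!: tendsto_eq_intros)
  then show ?thesis by (auto simp: filterlim_at eventually_at_filter)
qed

locale cusp_loop = turning_arc c \<theta> 0 1 for c \<theta> +
  assumes jordan: "jordan_param c" and cusp_at_0: "c 0 = 0"
    and increasing: "strict_mono_on {0..1} \<theta>"
    and start_angle: "\<theta> 0 = - pi/2" and end_direction: "cis (\<theta> 1) = \<i>"
    and inward: "\<forall>\<^sub>F \<sigma> in at_right 0. winding_number c (\<i> * of_real \<sigma>) = 1"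
begin

lemma end_at_0: "c 1 = 0"
  using jordan_param_add_1[OF jordan, of 0] cusp_at_0 by simp

lemma curve_inj: "0 \<le> s \<Longrightarrow> s < t \<Longrightarrow> t \<le> 1 \<Longrightarrow> t - s < 1 \<Longrightarrow> c s \<noteq> c t"
  using jordan_param_inj[OF jordan, of s t s] by auto

lemma curve_nonzero: "t \<in> {0<..<1} \<Longrightarrow> c t \<noteq> 0"
  using curve_inj[of 0 t] cusp_at_0 by auto

lemma start_quadrant:
  assumes "0 < s" "s \<le> 1" "\<theta> s \<le> 0"
  shows "Re (c s) > 0" "Im (c s) < 0"
proof -
  have "\<theta> 0 < \<theta> s" using assms by (intro strict_mono_onD[OF increasing]) auto
  then show "Re (c s) > 0" "Im (c s) < 0"
    using secant_left[of 0 s "-pi/2"] secant_right[of 0 s 0] assms start_angle cusp_at_0 by auto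
qed

lemma end_quadrant:
  assumes "0 \<le> s" "s < 1" "\<theta> 1 - pi/2 \<le> \<theta> s"
  shows "Re (c s) < 0" "Im (c s) < 0"
proof -
  have "\<theta> s < \<theta> 1" using assms by (intro strict_mono_onD[OF increasing]) auto
  have "cis (-(\<theta> 1 - pi)) = cis pi / cis (\<theta> 1)" "cis (-(\<theta> 1 - pi/2)) = cis (pi/2) / cis (\<theta> 1)"
    unfolding cis_divide by simp_all
  then have "cis (-(\<theta> 1 - pi)) = \<i>" "cis (-(\<theta> 1 - pi/2)) = 1" unfolding end_direction by simp_all
  then show "Re (c s) < 0" "Im (c s) < 0"
    using secant_left[of s 1 "\<theta> 1 - pi"] secant_left[of s 1 "\<theta> 1 - pi/2"] assms \<open>\<theta> s < \<theta> 1\<close> end_at_0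
    by (auto simp del: minus_diff_eq)
qed

lemma near_cusp:
  "\<forall>\<^sub>F \<epsilon> in at_right 0. 0 < \<epsilon> \<and> \<epsilon> < 1/2 \<and> \<theta> \<epsilon> \<le> 0 \<and> \<theta> 1 - pi/2 \<le> \<theta> (1 - \<epsilon>)"
proof -
  have "(\<theta> \<longlongrightarrow> \<theta> 0) (at_right 0)" "(\<theta> \<longlongrightarrow> \<theta> 1) (at_left 1)"
    using continuous_on_Icc_at_rightD[OF continuous_angle]
      continuous_on_Icc_at_leftD[OF continuous_angle] by auto
  then have "\<forall>\<^sub>F \<epsilon> in at_right 0. \<theta> \<epsilon> < 0" "\<forall>\<^sub>F t in at_left 1. \<theta> 1 - pi/2 < \<theta> t"
    by (auto intro: order_tendstoD simp: start_angle)
  moreover have "filterlim (\<lambda>\<epsilon>. 1 - \<epsilon>) (at_left 1) (at_right (0::real))"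
    by (rule filterlim_one_minus_at_left)
  ultimately have "\<forall>\<^sub>F \<epsilon> in at_right 0. \<theta> \<epsilon> < 0" "\<forall>\<^sub>F \<epsilon> in at_right 0. \<theta> 1 - pi/2 < \<theta> (1 - \<epsilon>)"
    by (auto simp: filterlim_iff)
  moreover have "\<forall>\<^sub>F \<epsilon> in at_right 0. 0 < \<epsilon> \<and> \<epsilon> < (1/2::real)"
    unfolding eventually_at_right_field by (intro exI[of _ "1/2"]) auto
  ultimately show ?thesis by eventually_elim auto
qed

lemma Im_neg_around_cusp:
  assumes "\<epsilon> < 1/2" "\<theta> \<epsilon> \<le> 0" "\<theta> 1 - pi/2 \<le> \<theta> (1 - \<epsilon>)" and x: "x \<in> {-\<epsilon>..\<epsilon>}" "x \<noteq> 0"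
  shows "Im (c x) < 0"
proof (cases "x > 0")
  case True
  then have "\<theta> x \<le> \<theta> \<epsilon>" using assms by (intro strict_mono_on_leD[OF increasing]) auto
  then show ?thesis using True assms by (intro start_quadrant) auto
next
  case False
  then have "\<theta> (1 - \<epsilon>) \<le> \<theta> (x + 1)" using assms by (intro strict_mono_on_leD[OF increasing]) auto
  then show ?thesis
    using False assms end_quadrant(2)[of "x + 1"] jordan_param_add_1[OF jordan, of x] by auto
qed

definition secant_domain :: "(real \<times> real) set" where
  "secant_domain = {(s, t). 0 \<le> s \<and> s \<le> t \<and> t \<le> 1 \<and> t - s < 1}"

definition secant_direction :: "real \<times> real \<Rightarrow> complex" where
  "secant_direction = (\<lambda>(s, t). if s = t then cis (\<theta> s) else sgn (c t - c s))"

lemma convex_secant_domain: "convex secant_domain"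
proof -
  have eq: "secant_domain = {z. inner (-1, 0) z \<le> 0} \<inter> {z. inner (1, -1) z \<le> 0}
      \<inter> {z. inner (0, 1) z \<le> 1} \<inter> {z. inner (-1, 1) z < 1}"
    by (auto simp: secant_domain_def inner_prod_def)
  show ?thesis unfolding eq by (intro convex_Int convex_halfspace_le convex_halfspace_lt)
qed

lemma sgn_secant_direction: "sgn (secant_direction z) = secant_direction z"
  by (cases z) (auto simp: secant_direction_def)

lemma secant_direction_nonzero: "z \<in> secant_domain \<Longrightarrow> secant_direction z \<noteq> 0"
  using curve_inj[of "fst z" "snd z"]
  by (cases z) (auto simp: secant_direction_def secant_domain_def sgn_zero_iff)

lemma secant_direction_between:
  assumes "(s, t) \<in> secant_domain" "\<theta> t - \<theta> s < pi"
  obtains w where "\<theta> s \<le> w" "w \<le> \<theta> t" "secant_direction (s, t) = cis w"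
proof (cases "s = t")
  case True
  then show thesis using that[of "\<theta> s"] by (simp add: secant_direction_def)
next
  case False
  then have st: "0 \<le> s" "s < t" "t \<le> 1" using assms(1) by (auto simp: secant_domain_def)
  then have "\<theta> s < \<theta> t" by (intro strict_mono_onD[OF increasing]) auto
  moreover obtain w where "min (\<theta> s) (\<theta> t) < w" "w < max (\<theta> s) (\<theta> t)" "sgn (c t - c s) = cis w"
    using secant_angle[OF st] \<open>\<theta> s < \<theta> t\<close> assms(2) by auto
  ultimately show thesis using that[of w] False by (simp add: secant_direction_def)
qed

lemma continuous_secant_direction_diagonal:
  assumes "s \<in> {0..1}"
  shows "continuous (at (s, s) within secant_domain) secant_direction"
proof -
  let ?F = "at (s, s) within secant_domain"
  have "\<forall>z. \<exists>w. z \<in> secant_domain \<and> \<theta> (snd z) - \<theta> (fst z) < pi \<longrightarrow>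
      \<theta> (fst z) \<le> w \<and> w \<le> \<theta> (snd z) \<and> secant_direction z = cis w"
    using secant_direction_between by (metis prod.collapse)
  then obtain w where w: "\<And>z. z \<in> secant_domain \<Longrightarrow> \<theta> (snd z) - \<theta> (fst z) < pi \<Longrightarrow>
      \<theta> (fst z) \<le> w z \<and> w z \<le> \<theta> (snd z) \<and> secant_direction z = cis (w z)" by metis
  have "continuous_on secant_domain (\<lambda>z. \<theta> (fst z))" "continuous_on secant_domain (\<lambda>z. \<theta> (snd z))"
    by (auto intro!: continuous_on_compose2[OF continuous_angle] continuous_intros simp: secant_domain_def)
  moreover have "(s, s) \<in> secant_domain" using assms by (simp add: secant_domain_def)
  ultimately have lim: "((\<lambda>z. \<theta> (fst z)) \<longlongrightarrow> \<theta> s) ?F" "((\<lambda>z. \<theta> (snd z)) \<longlongrightarrow> \<theta> s) ?F"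
    by (force simp: continuous_on_def)+
  have "((\<lambda>z. \<theta> (snd z) - \<theta> (fst z)) \<longlongrightarrow> 0) ?F" using tendsto_diff[OF lim(2,1)] by simp
  then have "\<forall>\<^sub>F z in ?F. \<theta> (snd z) - \<theta> (fst z) < pi" by (rule order_tendstoD) simp
  moreover have "\<forall>\<^sub>F z in ?F. z \<in> secant_domain" by (simp add: eventually_at_filter)
  ultimately have ev: "\<forall>\<^sub>F z in ?F. \<theta> (fst z) \<le> w z \<and> w z \<le> \<theta> (snd z) \<and> cis (w z) = secant_direction z"
    by eventually_elim (use w in metis)
  then have "(w \<longlongrightarrow> \<theta> s) ?F"
    by (intro tendsto_sandwich[OF _ _ lim]) (auto elim: eventually_mono)
  then have "((\<lambda>z. cis (w z)) \<longlongrightarrow> secant_direction (s, s)) ?F"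
    by (simp add: secant_direction_def tendsto_cis)
  then show ?thesis unfolding continuous_within
    by (rule Lim_transform_eventually) (use ev in \<open>auto elim: eventually_mono\<close>)
qed

lemma continuous_secant_direction: "continuous_on secant_domain secant_direction"
proof (rule continuous_on_from_open_part)
  let ?U = "secant_domain \<inter> {z. fst z \<noteq> snd z}"
  have "open {z::real \<times> real. fst z \<noteq> snd z}" by (intro open_Collect_neq continuous_intros)
  then show "openin (top_of_set secant_domain) ?U" by (rule openin_open_Int)
  have "continuous_on ?U (\<lambda>z. c (snd z))" "continuous_on ?U (\<lambda>z. c (fst z))"
    by (auto intro!: continuous_on_compose2[OF continuous_curve] continuous_intros simp: secant_domain_def)
  moreover have "c (snd z) - c (fst z) \<noteq> 0" if "z \<in> ?U" for z
    using curve_inj[of "fst z" "snd z"] that by (auto simp: secant_domain_def)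
  ultimately have "continuous_on ?U (\<lambda>z. sgn (c (snd z) - c (fst z)))"
    by (intro continuous_intros) auto
  then show "continuous_on ?U secant_direction"
    by (rule continuous_on_eq) (auto simp: secant_direction_def)
  fix z assume "z \<in> secant_domain - ?U"
  then show "continuous (at z within secant_domain) secant_direction"
    using continuous_secant_direction_diagonal by (auto simp: secant_domain_def)
qed

end

locale secant_angle_lift = cusp_loop +
  fixes A :: "real \<times> real \<Rightarrow> real"
  assumes continuous_lift: "continuous_on secant_domain A"
    and lift: "z \<in> secant_domain \<Longrightarrow> secant_direction z = cis (A z)"
    and lift_diagonal: "t \<in> {0..1} \<Longrightarrow> A (t, t) = \<theta> t"

lemma (in cusp_loop) secant_angle_lift_exists:
  obtains A where "secant_angle_lift c \<theta> A"
proof -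
  obtain B where B: "continuous_on secant_domain B"
    "\<And>z. z \<in> secant_domain \<Longrightarrow> sgn (secant_direction z) = cis (B z)"
    using continuous_angle_exists[OF continuous_secant_direction] secant_direction_nonzero
      convex_imp_contractible[OF convex_secant_domain] by blast
  have diagonal: "(t, t) \<in> secant_domain" if "t \<in> {0..1}" for t
    using that by (simp add: secant_domain_def)
  have cis: "cis (B (t, t)) = cis (\<theta> t)" if "t \<in> {0..1}" for t
    using B(2)[OF diagonal[OF that]] by (simp add: secant_direction_def)
  define k where "k = B (0, 0) - \<theta> 0"
  have k: "B (t, t) - \<theta> t = k" if "t \<in> {0..1}" for t
    unfolding k_def
  proof (rule cis_eq_imp_constant_diff[OF connected_Icc])
    show "continuous_on {0..1} (\<lambda>t. B (t, t))"
      using diagonal by (intro continuous_intros continuous_on_compose2[OF B(1)]) auto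
  qed (use that cis continuous_angle in auto)
  have "secant_angle_lift c \<theta> (\<lambda>z. B z - k)"
  proof
    show "continuous_on secant_domain (\<lambda>z. B z - k)" by (intro continuous_intros B(1))
    show "secant_direction z = cis (B z - k)" if "z \<in> secant_domain" for z
      using B(2)[OF that] sgn_secant_direction cis[of 0] by (simp add: k_def flip: cis_divide)
    show "B (t, t) - k = \<theta> t" if "t \<in> {0..1}" for t using k[OF that] by simp
  qed
  then show thesis by (rule that)
qed

context secant_angle_lift
begin

lemma lift_secant: "(s, t) \<in> secant_domain \<Longrightarrow> s \<noteq> t \<Longrightarrow> sgn (c t - c s) = cis (A (s, t))"
  using lift[of "(s, t)"] by (simp add: secant_direction_def)

lemma continuous_lift_from_start: "continuous_on {0..<1} (\<lambda>t. A (0, t))"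
  by (rule continuous_on_compose2[OF continuous_lift])
    (auto intro!: continuous_intros simp: secant_domain_def)

lemma continuous_lift_to_end: "continuous_on {0<..1} (\<lambda>t. A (t, 1))"
  by (rule continuous_on_compose2[OF continuous_lift])
    (auto intro!: continuous_intros simp: secant_domain_def)

lemma sgn_curve:
  assumes "t \<in> {0<..<1}"
  shows "sgn (c t) = cis (A (0, t))" "- sgn (c t) = cis (A (t, 1))"
  using lift_secant[of 0 t] lift_secant[of t 1] assms cusp_at_0 end_at_0
  by (auto simp: secant_domain_def sgn_minus)

lemma rotation_away_from_cusp:
  assumes "0 < \<epsilon>" "\<epsilon> < 1/2"
  shows "2 * pi * Re (winding_number (subpath \<epsilon> (1 - \<epsilon>) c) 0) = A (0, 1 - \<epsilon>) - A (0, \<epsilon>)"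
proof -
  define \<tau> where "\<tau> x = (1 - \<epsilon> - \<epsilon>) * x + \<epsilon>" for x
  have \<tau>: "\<tau> x \<in> {0<..<1}" if "x \<in> {0..1}" for x
  proof -
    have "(1 - \<epsilon> - \<epsilon>) * x \<ge> 0" using that assms by simp
    moreover have "(1 - \<epsilon> - \<epsilon>) * x \<le> 1 - \<epsilon> - \<epsilon>" using that assms by (simp add: mult_left_le)
    ultimately have "\<tau> x > 0 \<and> \<tau> x < 1" using assms unfolding \<tau>_def by argo
    then show ?thesis by simp
  qed
  have "2 * pi * Re (winding_number (subpath \<epsilon> (1 - \<epsilon>) c) 0) = A (0, \<tau> 1) - A (0, \<tau> 0)"
  proof (rule Re_winding_number_eq_angle_diff)
    show "path (subpath \<epsilon> (1 - \<epsilon>) c)"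
      by (rule path_subpath_continuous[OF jordan_param_continuous[OF jordan]])
    show "0 \<notin> path_image (subpath \<epsilon> (1 - \<epsilon>) c)"
      using curve_nonzero \<tau> by (force simp: path_image_def subpath_def \<tau>_def)
    have "continuous_on {0..1} \<tau>" unfolding \<tau>_def by (intro continuous_intros)
    then show "continuous_on {0..1} (\<lambda>x. A (0, \<tau> x))"
      using \<tau> by (intro continuous_on_compose2[OF continuous_lift_from_start]) force+
    show "sgn (subpath \<epsilon> (1 - \<epsilon>) c x - 0) = cis (A (0, \<tau> x))" if "x \<in> {0..1}" for x
      using sgn_curve(1)[OF \<tau>[OF that]] by (simp add: subpath_def \<tau>_def)
  qed
  then show ?thesis by (simp add: \<tau>_def)
qed

text \<open>The winding number around a point just behind the cusp is the rotation of the curve seen from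
  the cusp, up to the small angles at its two ends.\<close>
lemma rotation_from_cusp:
  "\<forall>\<^sub>F \<epsilon> in at_right 0. A (0, 1 - \<epsilon>) - A (0, \<epsilon>) = 2 * pi + Arg (\<i> * c (1 - \<epsilon>)) - Arg (\<i> * c \<epsilon>)"
  using near_cusp
proof eventually_elim
  case (elim \<epsilon>)
  let ?rest = "subpath \<epsilon> (1 - \<epsilon>) c"
  have before: "c (- \<epsilon>) = c (1 - \<epsilon>)" using jordan_param_add_1[OF jordan, of "- \<epsilon>"] by simp
  have "((\<lambda>\<sigma>. winding_number c (c 0 - of_real \<sigma> / \<i>)) \<longlongrightarrow>
      (Ln (\<i> * (c \<epsilon> - c 0)) - Ln (\<i> * (c (- \<epsilon>) - c 0))) / (2 * of_real pi * \<i>)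
      + winding_number (subpath \<epsilon> (- \<epsilon> + 1) c) (c 0)) (at_right 0)"
  proof (rule jordan_param_winding_number_tendsto_along_slit(1)[OF jordan])
    show "\<forall>x\<in>{-\<epsilon>..\<epsilon>} - {0}. \<i> * (c x - c 0) \<notin> \<real>\<^sub>\<le>\<^sub>0"
      using Im_neg_around_cusp[of \<epsilon>] elim by (auto simp: cusp_at_0 complex_nonpos_Reals_iff not_le)
  qed (use elim in auto)
  moreover have "c 0 - of_real \<sigma> / \<i> = \<i> * of_real \<sigma>" for \<sigma> by (simp add: cusp_at_0)
  ultimately have lim: "((\<lambda>\<sigma>. winding_number c (\<i> * of_real \<sigma>)) \<longlongrightarrow>
      (Ln (\<i> * c \<epsilon>) - Ln (\<i> * c (1 - \<epsilon>))) / (2 * of_real pi * \<i>) + winding_number ?rest 0) (at_right 0)"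
    by (simp only: cusp_at_0 before diff_zero uminus_add_conv_diff)
  have "((\<lambda>\<sigma>. winding_number c (\<i> * of_real \<sigma>)) \<longlongrightarrow> 1) (at_right 0)"
    using inward by (rule tendsto_eventually)
  from tendsto_unique[OF _ lim this] have
    "(Ln (\<i> * c \<epsilon>) - Ln (\<i> * c (1 - \<epsilon>))) / (2 * of_real pi * \<i>) + winding_number ?rest 0 = 1" by simp
  then have "2 * pi * Re ((Ln (\<i> * c \<epsilon>) - Ln (\<i> * c (1 - \<epsilon>))) / (2 * of_real pi * \<i>))
      + 2 * pi * Re (winding_number ?rest 0) = 2 * pi"
    by (metis one_complex.sel(1) plus_complex.sel(1) distrib_left mult.right_neutral)
  moreover have "2 * pi * Re (z / (2 * of_real pi * \<i>)) = Im z" for z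
    by (simp add: Re_divide power2_eq_square)
  moreover have "2 * pi * Re (winding_number ?rest 0) = A (0, 1 - \<epsilon>) - A (0, \<epsilon>)"
    using elim by (intro rotation_away_from_cusp) auto
  moreover have "c \<epsilon> \<noteq> 0" "c (1 - \<epsilon>) \<noteq> 0" using curve_nonzero elim by auto
  ultimately show ?case by (simp add: Arg_eq_Im_Ln)
qed

lemma rotation_to_cusp:
  assumes "s \<in> {0<..<1}" "t \<in> {0<..<1}"
  shows "A (t, 1) - A (s, 1) = A (0, t) - A (0, s)"
proof -
  have "A (t, 1) - (A (0, t) + pi) = A (s, 1) - (A (0, s) + pi)"
  proof (rule cis_eq_imp_constant_diff[OF connected_Ioo])
    show "continuous_on {0<..<1} (\<lambda>t. A (t, 1))" "continuous_on {0<..<1} (\<lambda>t. A (0, t) + pi)"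
      by (auto intro!: continuous_intros continuous_on_subset[OF continuous_lift_from_start]
          continuous_on_subset[OF continuous_lift_to_end])
    show "cis (A (t, 1)) = cis (A (0, t) + pi)" if "t \<in> {0<..<1}" for t
      using sgn_curve[OF that] by (simp flip: minus_cis)
  qed (use assms in auto)
  then show ?thesis by simp
qed

text \<open>All secants from the start to the end of the loop point into the left half-plane.\<close>
lemma rotation_at_excluded_corner:
  "\<forall>\<^sub>F \<epsilon> in at_right 0. A (\<epsilon>, 1) - A (0, 1 - \<epsilon>) = Arg (c \<epsilon>) - Arg (- c (1 - \<epsilon>))"
  using near_cusp
proof eventually_elim
  case (elim \<epsilon>)
  define N where "N = {0..\<epsilon>} \<times> {1 - \<epsilon>..1} \<inter> {z. inner (-1, 1) z < 1}"
  have N: "N \<subseteq> secant_domain" using elim by (auto simp: N_def secant_domain_def inner_prod_def)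
  have Re_pos: "Re (c (fst z) - c (snd z)) > 0" if "z \<in> N" for z
  proof -
    obtain s t where z: "z = (s, t)" by fastforce
    then have st: "0 \<le> s" "s \<le> \<epsilon>" "1 - \<epsilon> \<le> t" "t \<le> 1" "t - s < 1"
      using that by (auto simp: N_def inner_prod_def)
    have "s = 0 \<or> Re (c s) > 0"
      using start_quadrant(1)[of s] strict_mono_on_leD[OF increasing, of s \<epsilon>] st elim by force
    moreover have "t = 1 \<or> Re (c t) < 0"
      using end_quadrant(1)[of t] strict_mono_on_leD[OF increasing, of "1 - \<epsilon>" t] st elim by force
    ultimately show ?thesis using st cusp_at_0 end_at_0 by (auto simp: z)
  qed
  let ?Arg = "\<lambda>z. Arg (c (fst z) - c (snd z))"
  have "A (\<epsilon>, 1) - (?Arg (\<epsilon>, 1) + pi) = A (0, 1 - \<epsilon>) - (?Arg (0, 1 - \<epsilon>) + pi)"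
  proof (rule cis_eq_imp_constant_diff)
    show "connected N"
      unfolding N_def by (intro convex_connected convex_Int convex_Times convex_halfspace_lt) auto
    show "continuous_on N A" using continuous_lift N by (rule continuous_on_subset)
    have "c (fst z) - c (snd z) \<notin> \<real>\<^sub>\<le>\<^sub>0" if "z \<in> N" for z
      using Re_pos[OF that] by (simp add: complex_nonpos_Reals_iff)
    then show "continuous_on N (\<lambda>z. ?Arg z + pi)"
      by (intro continuous_intros continuous_on_compose2[OF continuous_curve])
        (use N in \<open>auto simp: secant_domain_def\<close>)
    show "cis (A z) = cis (?Arg z + pi)" if "z \<in> N" for z
    proof -
      have "c (fst z) - c (snd z) \<noteq> 0" using Re_pos[OF that] by auto
      moreover have "sgn (c (snd z) - c (fst z)) = cis (A z)"
        using lift_secant[of "fst z" "snd z"] N that elim by (auto simp: N_def)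
      moreover have "sgn (c (snd z) - c (fst z)) = - sgn (c (fst z) - c (snd z))"
        using sgn_minus[of "c (fst z) - c (snd z)"] by simp
      ultimately show ?thesis by (simp add: cis_Arg flip: minus_cis)
    qed
  qed (use elim in \<open>auto simp: N_def inner_prod_def\<close>)
  then show ?case by (simp add: cusp_at_0 end_at_0)
qed

lemma lift_limits:
  "((\<lambda>\<epsilon>. A (0, \<epsilon>)) \<longlongrightarrow> \<theta> 0) (at_right 0)"
  "((\<lambda>\<epsilon>. A (1 - \<epsilon>, 1)) \<longlongrightarrow> \<theta> 1) (at_right 0)"
proof -
  have "continuous_on {0..1/2} (\<lambda>t. A (0, t))" "continuous_on {1/2..1} (\<lambda>t. A (t, 1))"
    by (auto intro: continuous_on_subset[OF continuous_lift_from_start]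
        continuous_on_subset[OF continuous_lift_to_end])
  from continuous_on_Icc_at_rightD[OF this(1)] continuous_on_Icc_at_leftD[OF this(2)]
  show "((\<lambda>\<epsilon>. A (0, \<epsilon>)) \<longlongrightarrow> \<theta> 0) (at_right 0)"
    "((\<lambda>\<epsilon>. A (1 - \<epsilon>, 1)) \<longlongrightarrow> \<theta> 1) (at_right 0)"
    using filterlim_compose[OF _ filterlim_one_minus_at_left] by (simp_all add: lift_diagonal)
qed

lemma direction_limits:
  "((\<lambda>\<epsilon>. sgn (c \<epsilon>)) \<longlongrightarrow> - \<i>) (at_right 0)"
  "((\<lambda>\<epsilon>. sgn (c (1 - \<epsilon>))) \<longlongrightarrow> - \<i>) (at_right 0)"
proof -
  have "((\<lambda>\<epsilon>. cis (A (0, \<epsilon>))) \<longlongrightarrow> - \<i>) (at_right 0)"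
    using tendsto_cis[OF lift_limits(1)] by (simp add: start_angle)
  moreover have "((\<lambda>\<epsilon>. - cis (A (1 - \<epsilon>, 1))) \<longlongrightarrow> - \<i>) (at_right 0)"
    using tendsto_minus[OF tendsto_cis[OF lift_limits(2)]] by (simp add: end_direction)
  moreover have "\<forall>\<^sub>F \<epsilon> in at_right 0. cis (A (0, \<epsilon>)) = sgn (c \<epsilon>) \<and> - cis (A (1 - \<epsilon>, 1)) = sgn (c (1 - \<epsilon>))"
    using near_cusp by eventually_elim (simp flip: sgn_curve)
  ultimately show "((\<lambda>\<epsilon>. sgn (c \<epsilon>)) \<longlongrightarrow> - \<i>) (at_right 0)"
    "((\<lambda>\<epsilon>. sgn (c (1 - \<epsilon>))) \<longlongrightarrow> - \<i>) (at_right 0)"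
    by (auto elim: Lim_transform_eventually eventually_mono)
qed

lemma Arg_limits:
  "((\<lambda>\<epsilon>. Arg (\<i> * c \<epsilon>)) \<longlongrightarrow> 0) (at_right 0)"
  "((\<lambda>\<epsilon>. Arg (\<i> * c (1 - \<epsilon>))) \<longlongrightarrow> 0) (at_right 0)"
  "((\<lambda>\<epsilon>. Arg (c \<epsilon>)) \<longlongrightarrow> - (pi/2)) (at_right 0)"
  "((\<lambda>\<epsilon>. Arg (- c (1 - \<epsilon>))) \<longlongrightarrow> pi/2) (at_right 0)"
proof -
  have lim: "((\<lambda>\<epsilon>. Arg (w * z \<epsilon>)) \<longlongrightarrow> Arg (w * - \<i>)) (at_right 0)"
    if "((\<lambda>\<epsilon>. sgn (z \<epsilon>)) \<longlongrightarrow> - \<i>) (at_right 0)" "w * - \<i> \<notin> \<real>\<^sub>\<le>\<^sub>0" for w z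
  proof -
    have "Arg (w * sgn x) = Arg (w * x)" for x
      using Arg_divide_of_real[of "norm x" "w * x"] by (cases "x = 0") (simp_all add: sgn_eq)
    then show ?thesis using tendsto_Arg[OF tendsto_mult_left[OF that(1)] that(2)] by simp
  qed
  show "((\<lambda>\<epsilon>. Arg (\<i> * c \<epsilon>)) \<longlongrightarrow> 0) (at_right 0)"
    "((\<lambda>\<epsilon>. Arg (\<i> * c (1 - \<epsilon>))) \<longlongrightarrow> 0) (at_right 0)"
    "((\<lambda>\<epsilon>. Arg (c \<epsilon>)) \<longlongrightarrow> - (pi/2)) (at_right 0)"
    "((\<lambda>\<epsilon>. Arg (- c (1 - \<epsilon>))) \<longlongrightarrow> pi/2) (at_right 0)"
    using lim[OF direction_limits(1), of \<i>] lim[OF direction_limits(2), of \<i>]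
      lim[OF direction_limits(1), of 1] lim[OF direction_limits(2), of "-1"]
    by (simp_all add: complex_nonpos_Reals_iff)
qed

lemma end_angle: "\<theta> 1 = 5 * pi/2"
proof -
  have "((\<lambda>\<epsilon>. 2 * (2 * pi + Arg (\<i> * c (1 - \<epsilon>)) - Arg (\<i> * c \<epsilon>)) + (Arg (c \<epsilon>) - Arg (- c (1 - \<epsilon>))))
      \<longlongrightarrow> 2 * (2 * pi + 0 - 0) + (- (pi/2) - pi/2)) (at_right 0)"
    by (intro tendsto_intros Arg_limits)
  moreover have "\<forall>\<^sub>F \<epsilon> in at_right 0.
      2 * (2 * pi + Arg (\<i> * c (1 - \<epsilon>)) - Arg (\<i> * c \<epsilon>)) + (Arg (c \<epsilon>) - Arg (- c (1 - \<epsilon>)))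
      = A (1 - \<epsilon>, 1) - A (0, \<epsilon>)"
    using near_cusp rotation_from_cusp rotation_at_excluded_corner
  proof eventually_elim
    case (elim \<epsilon>)
    then have "A (1 - \<epsilon>, 1) - A (\<epsilon>, 1) = A (0, 1 - \<epsilon>) - A (0, \<epsilon>)" by (intro rotation_to_cusp) auto
    then show ?case using elim by simp
  qed
  ultimately have "((\<lambda>\<epsilon>. A (1 - \<epsilon>, 1) - A (0, \<epsilon>)) \<longlongrightarrow> 2 * (2 * pi + 0 - 0) + (- (pi/2) - pi/2)) (at_right 0)"
    by (rule Lim_transform_eventually)
  from tendsto_unique[OF _ this tendsto_diff[OF lift_limits(2,1)]] show ?thesis
    by (simp add: start_angle)
qed

lemma crosses_axis_above_cusp: "\<exists>t\<in>{0..1}. \<exists>y>0. c t = \<i> * of_real y"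
proof -
  have "((\<lambda>\<epsilon>. A (0, \<epsilon>) + (2 * pi + Arg (\<i> * c (1 - \<epsilon>)) - Arg (\<i> * c \<epsilon>)))
      \<longlongrightarrow> \<theta> 0 + (2 * pi + 0 - 0)) (at_right 0)"
    by (intro tendsto_intros lift_limits Arg_limits)
  then have "\<forall>\<^sub>F \<epsilon> in at_right 0. A (0, \<epsilon>) + (2 * pi + Arg (\<i> * c (1 - \<epsilon>)) - Arg (\<i> * c \<epsilon>)) > pi/2"
    by (rule order_tendstoD) (simp add: start_angle)
  with near_cusp rotation_from_cusp have "\<forall>\<^sub>F \<epsilon> in at_right 0. \<epsilon> \<in> {0<..<1/2} \<and> A (0, 1 - \<epsilon>) > pi/2"
    by eventually_elim auto
  then obtain \<epsilon> where \<epsilon>: "\<epsilon> \<in> {0<..<1/2}" "A (0, 1 - \<epsilon>) > pi/2"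
    using eventually_happens trivial_limit_at_right_real by blast
  have "\<exists>t\<ge>0. t \<le> 1 - \<epsilon> \<and> A (0, t) = pi/2"
  proof (rule IVT')
    show "A (0, 0) \<le> pi/2" using lift_diagonal[of 0] by (simp add: start_angle)
    show "continuous_on {0..1 - \<epsilon>} (\<lambda>t. A (0, t))"
      using continuous_lift_from_start by (rule continuous_on_subset) (use \<epsilon> in auto)
  qed (use \<epsilon> in auto)
  then obtain t where t: "0 \<le> t" "t \<le> 1 - \<epsilon>" "A (0, t) = pi/2" by blast
  then have "t \<noteq> 0" using lift_diagonal[of 0] by (auto simp: start_angle)
  then have t01: "t \<in> {0<..<1}" using t \<epsilon> by auto
  then have "c t = \<i> * of_real (norm (c t))"
    using sgn_curve(1)[OF t01] t(3) curve_nonzero[OF t01] by (simp add: sgn_eq divide_eq_eq)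
  then show ?thesis using curve_nonzero[OF t01] t01
    by (intro bexI[of _ t] exI[of _ "norm (c t)"]) auto
qed

end

locale cardioid_by_angle = turning_arc K "\<lambda>p. p" "-pi/2" "5*pi/2" for K +
  assumes K_start [simp]: "K (- (pi/2)) = 0" and K_end [simp]: "K (5*pi/2) = 0"
    and crosses_axis: "\<exists>p\<in>{-pi/2..5*pi/2}. \<exists>y>0. K p = \<i> * of_real y"

lemma (in cusp_loop) cardioid_by_angle_exists:
  obtains K where "cardioid_by_angle K" "K ` {-pi/2..5*pi/2} = path_image c"
proof -
  obtain A where "secant_angle_lift c \<theta> A" by (rule secant_angle_lift_exists)
  then interpret secant_angle_lift c \<theta> A .
  obtain u where u: "turning_arc (c \<circ> u) (\<lambda>p. p) (\<theta> 0) (\<theta> 1)"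
    "u ` {\<theta> 0..\<theta> 1} = {0..1}" "\<And>x. x \<in> {0..1} \<Longrightarrow> u (\<theta> x) = x"
    using reparametrize_by_angle[OF increasing] by blast
  note angles = start_angle end_angle
  interpret K: turning_arc "c \<circ> u" "\<lambda>p. p" "-pi/2" "5*pi/2" using u(1) unfolding angles .
  have "cardioid_by_angle (c \<circ> u)"
  proof
    show "(c \<circ> u) (- (pi/2)) = 0" "(c \<circ> u) (5*pi/2) = 0"
      using u(3)[of 0] u(3)[of 1] by (simp_all add: angles cusp_at_0 end_at_0)
    obtain t y where t: "t \<in> {0..1}" "y > 0" "c t = \<i> * of_real y" using crosses_axis_above_cusp by blast
    obtain p where "p \<in> {-pi/2..5*pi/2}" "u p = t" using u(2) t(1) unfolding angles by (metis imageE)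
    then show "\<exists>p\<in>{-pi/2..5*pi/2}. \<exists>y>0. (c \<circ> u) p = \<i> * of_real y" using t by auto
  qed
  moreover have "(c \<circ> u) ` {-pi/2..5*pi/2} = path_image c"
    using u(2) unfolding angles by (simp only: path_image_def image_comp[symmetric])
  ultimately show thesis by (rule that)
qed

section \<open>Tangent angles of the two curves\<close>

lemma vd_iter_1_add_1:
  assumes "\<And>t. g (t + 1) = g t"
  shows "vd_iter 1 g (t + 1) = vd_iter 1 g t"
proof -
  have shift: "(g has_vector_derivative d) (at (x + k))"
    if "(g has_vector_derivative d) (at x)" "\<And>t. g (t - k) = g t" for d x k
  proof -
    have "((g \<circ> (\<lambda>x. x - k)) has_vector_derivative 1 *\<^sub>R d) (at (x + k))"
      by (rule vector_diff_chain_at) (use that(1) in \<open>auto intro!: derivative_eq_intros\<close>)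
    then show ?thesis using that(2) by (simp add: o_def)
  qed
  have "g (t - 1) = g t" for t using assms[of "t - 1"] by simp
  then have "(g has_vector_derivative d) (at (t + 1)) \<longleftrightarrow> (g has_vector_derivative d) (at t)" for d
    using shift[of d t 1] shift[of d "t + 1" "-1"] assms by auto
  then show ?thesis by (simp add: vector_derivative_def)
qed

lemma cusp_add_1_at_left:
  assumes "jordan_param g" "cusp g t v"
  shows "((\<lambda>x. sgn (vd_iter 1 g x)) \<longlongrightarrow> - v) (at_left (t + 1))"
proof -
  have "at_left (t + 1) = filtermap (\<lambda>x. x + 1) (at_left t)"
    using filtermap_at_left_shift[of "-1" t] by simp
  then show ?thesis
    using cuspD(3)[OF assms(2)] vd_iter_1_add_1[of g, OF jordan_param_add_1[OF assms(1)]]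
    by (simp add: filterlim_filtermap del: vd_iter.simps)
qed

lemma strict_mono_on_if_DERIV_pos:
  fixes f :: "real \<Rightarrow> real"
  assumes "continuous_on {a..b} f" "\<And>t. t \<in> {a<..<b} \<Longrightarrow> \<exists>d. (f has_real_derivative d) (at t) \<and> d > 0"
  shows "strict_mono_on {a..b} f"
proof (rule strict_mono_onI)
  fix x y assume xy: "x \<in> {a..b}" "y \<in> {a..b}" "x < y"
  show "f x < f y"
    by (rule DERIV_pos_imp_increasing_open[OF xy(3)])
      (use xy assms in \<open>auto intro: continuous_on_subset\<close>)
qed

lemma strict_antimono_on_if_DERIV_neg:
  fixes f :: "real \<Rightarrow> real"
  assumes "continuous_on {a..b} f" "\<And>t. t \<in> {a<..<b} \<Longrightarrow> \<exists>d. (f has_real_derivative d) (at t) \<and> d < 0"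
  shows "strict_antimono_on {a..b} f"
proof (rule monotone_onI)
  fix x y assume xy: "x \<in> {a..b}" "y \<in> {a..b}" "x < y"
  show "f y < f x"
    by (rule DERIV_neg_imp_decreasing_open[OF xy(3)])
      (use xy assms in \<open>auto intro: continuous_on_subset\<close>)
qed

lemma cardioid_param_turning_arc:
  assumes "cardioid_param g t0" "cusp g t0 v"
  obtains \<theta> where "turning_arc g \<theta> t0 (t0 + 1)" "strict_mono_on {t0..t0 + 1} \<theta>"
    "cis (\<theta> t0) = v" "cis (\<theta> (t0 + 1)) = - v"
proof -
  let ?S = "{t. \<forall>k::int. t \<noteq> t0 + of_int k}"
  have J: "jordan_param g" and smooth: "smooth_regular_on g ?S"
    and curv: "\<And>t. t \<in> ?S \<Longrightarrow> curvature g t > 0"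
    using assms by (auto simp: cardioid_param_def)
  have sub: "{t0<..<t0 + 1} \<subseteq> ?S"
  proof safe
    fix k :: int assume "t0 + of_int k \<in> {t0<..<t0 + 1}"
    then have "0 < real_of_int k" "real_of_int k < 1" by auto
    then show False by simp
  qed
  obtain \<theta> where \<theta>: "continuous_on {t0..t0 + 1} \<theta>" "cis (\<theta> t0) = v" "cis (\<theta> (t0 + 1)) = - v"
    "\<And>t. t \<in> {t0<..<t0 + 1} \<Longrightarrow> sgn (vd_iter 1 g t) = cis (\<theta> t)"
    "\<And>t. t \<in> {t0<..<t0 + 1} \<Longrightarrow> (\<theta> has_real_derivative curvature g t * norm (vd_iter 1 g t)) (at t)"
    using smooth_regular_arc_tangent_angle[OF smooth sub _ cuspD(2,1)[OF assms(2)]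
        cusp_add_1_at_left[OF J assms(2)]]
      cuspD(1)[OF assms(2)] by auto
  have "curvature g t * norm (vd_iter 1 g t) > 0" if "t \<in> {t0<..<t0 + 1}" for t
    using that curv smooth_regular_onD(3)[OF smooth] sub by (simp add: subset_iff del: vd_iter.simps)
  then have increasing: "strict_mono_on {t0..t0 + 1} \<theta>"
    using \<theta>(5) by (intro strict_mono_on_if_DERIV_pos \<theta>(1)) blast
  have "turning_arc g \<theta> t0 (t0 + 1)"
    using smooth_regular_onD(1)[OF smooth] sub \<theta>(4) increasing
    by (intro turning_arc_if_tangent_angle[where c' = "vd_iter 1 g"] jordan_param_continuous J \<theta>(1)) auto
  then show thesis using that increasing \<theta>(2,3) by blast
qed

lemma cardioid_param_cusp_loop:
  assumes "cardioid_param g t0"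
  obtains \<eta> \<theta> where "cusp_loop (\<lambda>x. cis \<eta> * g (t0 + x) + - cis \<eta> * g t0) \<theta>"
proof -
  have J: "jordan_param g" "ccw g" using assms by (auto simp: cardioid_param_def)
  obtain v where v: "cusp g t0 v" "\<forall>\<^sub>F s in at_right 0. g t0 - of_real s * v \<in> inside (path_image g)"
    using assms by (auto simp: cardioid_param_def inward_cusp_def)
  obtain \<theta> where \<theta>: "turning_arc g \<theta> t0 (t0 + 1)" "strict_mono_on {t0..t0 + 1} \<theta>"
    "cis (\<theta> t0) = v" "cis (\<theta> (t0 + 1)) = - v"
    by (rule cardioid_param_turning_arc[OF assms v(1)])
  define \<eta> where "\<eta> = - pi/2 - \<theta> t0"
  have "v \<noteq> 0" using cuspD(1)[OF v(1)] by auto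
  have \<eta>: "cis \<eta> = - \<i> / v"
    unfolding \<eta>_def cis_divide[symmetric] \<theta>(3) by (simp add: complex_eq_iff)
  let ?c = "\<lambda>x. cis \<eta> * g (t0 + x) + - cis \<eta> * g t0" and ?\<theta> = "\<lambda>x. \<theta> (t0 + x) + \<eta>"
  have "turning_arc ?c ?\<theta> 0 1"
    using turning_arc.rotate_shift[OF \<theta>(1), of \<eta> t0 "- cis \<eta> * g t0"] by simp
  moreover have "jordan_param ?c" by (rule jordan_param_affine_shift(1)[OF J(1)]) simp
  moreover have "strict_mono_on {0..1} ?\<theta>"
    using \<theta>(2) by (auto simp: strict_mono_on_def)
  moreover have "cis (?\<theta> 1) = \<i>" using \<theta>(4) \<eta> \<open>v \<noteq> 0\<close> by (simp flip: cis_mult)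
  moreover have "\<forall>\<^sub>F \<sigma> in at_right 0. winding_number ?c (\<i> * of_real \<sigma>) = 1"
    using v(2)
  proof eventually_elim
    case (elim \<sigma>)
    let ?z = "g t0 - of_real \<sigma> * v"
    have "cis \<eta> * ?z + - cis \<eta> * g t0 = \<i> * of_real \<sigma>"
      using \<open>v \<noteq> 0\<close> by (simp add: \<eta> algebra_simps)
    moreover have "?z \<notin> path_image g" using elim by (simp add: inside_def)
    ultimately show ?case
      using jordan_param_affine_shift(3)[OF J(1), of "cis \<eta>" ?z t0 "- cis \<eta> * g t0"] J(2) elim
      by (simp add: ccw_def)
  qed
  ultimately have "cusp_loop ?c ?\<theta>"
    by (simp add: cusp_loop_def cusp_loop_axioms_def \<eta>_def)
  then show thesis by (rule that)
qed

lemma cardioid_like_by_angle: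
  assumes "cardioid_like C"
  obtains K a b where "cardioid_by_angle K" "a \<noteq> 0" "K ` {-pi/2..5*pi/2} = (\<lambda>z. a * z + b) ` C"
proof -
  obtain g t0 where g: "cardioid_param g t0" "C = path_image g"
    using assms by (auto simp: cardioid_like_def)
  obtain \<eta> \<theta> where "cusp_loop (\<lambda>x. cis \<eta> * g (t0 + x) + - cis \<eta> * g t0) \<theta>"
    by (rule cardioid_param_cusp_loop[OF g(1)])
  then interpret cusp_loop "\<lambda>x. cis \<eta> * g (t0 + x) + - cis \<eta> * g t0" \<theta> .
  obtain K where K: "cardioid_by_angle K"
    "K ` {-pi/2..5*pi/2} = path_image (\<lambda>x. cis \<eta> * g (t0 + x) + - cis \<eta> * g t0)"
    by (rule cardioid_by_angle_exists)
  have "jordan_param g" using g(1) by (simp add: cardioid_param_def)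
  then have "K ` {-pi/2..5*pi/2} = (\<lambda>z. cis \<eta> * z + - cis \<eta> * g t0) ` C"
    unfolding K(2) g(2) by (rule jordan_param_affine_shift(2)) simp
  then show thesis using that[OF K(1) cis_neq_zero] by blast
qed

locale concave_turning_arc = turning_arc g \<theta> t1 t2 for g \<theta> t1 t2 +
  assumes decreasing: "strict_antimono_on {t1..t2} \<theta>"
    and total_turning: "\<theta> t1 - \<theta> t2 < pi"

lemma concave_arc_turning_arc:
  assumes smooth: "smooth_regular_on g S" "{a<..<b} \<subseteq> S" and "a < b" and cont: "continuous_on {a..b} g"
    and cusps: "cusp g a v" "cusp g b w" and concave: "concave_arc g a b"
  obtains \<theta> where "concave_turning_arc g \<theta> a b"
proof -
  have "norm (- w) = 1" using cuspD(1)[OF cusps(2)] by simp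
  then obtain \<theta> where \<theta>: "continuous_on {a..b} \<theta>"
    "\<And>t. t \<in> {a<..<b} \<Longrightarrow> sgn (vd_iter 1 g t) = cis (\<theta> t)"
    "\<And>t. t \<in> {a<..<b} \<Longrightarrow> (\<theta> has_real_derivative curvature g t * norm (vd_iter 1 g t)) (at t)"
    using smooth_regular_arc_tangent_angle[OF smooth \<open>a < b\<close> cuspD(2,1)[OF cusps(1)] cuspD(3)[OF cusps(2)]]
    by blast
  have curv: "curvature g t < 0" if "t \<in> {a<..<b}" for t using concave that by (simp add: concave_arc_def)
  have "curvature g t * norm (vd_iter 1 g t) < 0" if "t \<in> {a<..<b}" for t
    using that curv smooth_regular_onD(3)[OF smooth(1)] smooth(2)
    by (simp add: mult_neg_pos subset_iff del: vd_iter.simps)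
  then have decreasing: "strict_antimono_on {a..b} \<theta>"
    using \<theta>(3) by (intro strict_antimono_on_if_DERIV_neg \<theta>(1)) blast
  have turning: "((\<lambda>t. \<bar>curvature g t\<bar> * norm (vd_iter 1 g t)) has_integral (- \<theta> b - - \<theta> a)) {a..b}"
  proof (rule fundamental_theorem_of_calculus_interior)
    show "continuous_on {a..b} (\<lambda>t. - \<theta> t)" by (intro continuous_intros \<theta>)
    show "((\<lambda>t. - \<theta> t) has_vector_derivative \<bar>curvature g t\<bar> * norm (vd_iter 1 g t)) (at t)"
      if "t \<in> {a<..<b}" for t
      using DERIV_minus[OF \<theta>(3)[OF that]] curv[OF that]
      by (simp add: has_real_derivative_iff_has_vector_derivative)
  qed (use \<open>a < b\<close> in simp)
  obtain V where V: "((\<lambda>t. \<bar>curvature g t\<bar> * norm (vd_iter 1 g t)) has_integral V) {a..b}" "V < pi"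
    using concave by (auto simp only: concave_arc_def tangent_variation_less_def)
  then have "\<theta> a - \<theta> b < pi" using has_integral_unique[OF V(1) turning] by simp
  moreover have "turning_arc g \<theta> a b"
    using smooth_regular_onD(1)[OF smooth(1)] smooth(2) \<theta>(2) decreasing
    by (intro turning_arc_if_tangent_angle[where c' = "vd_iter 1 g"] \<open>a < b\<close> cont \<theta>(1)) auto
  ultimately show thesis
    using that decreasing by (simp add: concave_turning_arc_def concave_turning_arc_axioms_def)
qed

lemma deltoid_concave_turning_arc:
  assumes deltoid: "deltoid_param g t1 t2 t3" and concave: "concave_arc g t1 t2"
  obtains \<theta> where "concave_turning_arc g \<theta> t1 t2"
proof -
  let ?S = "{t. \<forall>k::int. t \<noteq> t1 + of_int k \<and> t \<noteq> t2 + of_int k \<and> t \<noteq> t3 + of_int k}"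
  have order: "t1 < t2" "t2 < t3" "t3 < t1 + 1" using deltoid by (auto simp: deltoid_param_def)
  have "{t1<..<t2} \<subseteq> ?S"
  proof safe
    fix k :: int
    have "k \<le> -1 \<or> k = 0 \<or> k \<ge> 1" by linarith
    then have k: "real_of_int k \<le> -1 \<or> real_of_int k = 0 \<or> real_of_int k \<ge> 1" by auto
    show "t1 + of_int k \<in> {t1<..<t2} \<Longrightarrow> False" "t2 + of_int k \<in> {t1<..<t2} \<Longrightarrow> False"
      "t3 + of_int k \<in> {t1<..<t2} \<Longrightarrow> False"
      unfolding greaterThanLessThan_iff using k order by linarith+
  qed
  moreover obtain v w where "cusp g t1 v" "cusp g t2 w"
    using deltoid by (auto simp: deltoid_param_def outward_cusp_def)
  moreover have "smooth_regular_on g ?S" "continuous_on {t1..t2} g"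
    using deltoid jordan_param_continuous by (auto simp: deltoid_param_def)
  ultimately show thesis
    using concave_arc_turning_arc[OF _ _ order(1) _ _ _ concave] that by blast
qed

section \<open>The position of a cardioid relative to two tangent lines\<close>

context cardioid_by_angle
begin

lemma Re_right_foot_pos:
  assumes "-pi/2 < p" "p \<le> pi/2"
  shows "Re (K p) > 0"
  using secant_left[of "-pi/2" p "-pi/2"] assms pi_gt_zero by simp

lemma Re_left_foot_neg:
  assumes "3 * pi/2 \<le> p" "p < 5 * pi/2"
  shows "Re (K p) < 0"
  using secant_left_cong[of p "5*pi/2" "3*pi/2" "-pi/2"] assms cis_add_2pi[of "-pi/2"] by simp

lemma axis_crossing:
  obtains x y where "pi/2 < x" "x < 3 * pi/2" "y > 0" "K x = \<i> * of_real y"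
proof -
  obtain x y where x: "x \<in> {-pi/2..5*pi/2}" "y > 0" "K x = \<i> * of_real y" using crosses_axis by blast
  then have "K x \<noteq> 0" "Re (K x) = 0" by auto
  then have "x \<noteq> - (pi/2)" "x \<noteq> 5*pi/2" using K_start K_end by metis+
  moreover have "\<not> (-pi/2 < x \<and> x \<le> pi/2)" "\<not> (3*pi/2 \<le> x \<and> x < 5*pi/2)"
    using Re_right_foot_pos[of x] Re_left_foot_neg[of x] \<open>Re (K x) = 0\<close> by auto
  ultimately show thesis using that[of x y] x by auto
qed

lemma height_right_tangent:
  assumes u: "-pi/2 < u" "u < pi/2" and q: "-pi/2 \<le> q" "q \<le> u + pi" "q \<noteq> u"
  shows "height u (K q) > 0"
proof (cases "q < u")
  case True
  then have "Im (cis (-u) * (K u - K q)) < 0" using u q by (intro secant_right) auto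
  then show ?thesis using height_diff[of u "K u" "K q"] by simp
next
  case False
  then show ?thesis unfolding height_def using u q by (intro secant_left) auto
qed

lemma height_left_tangent:
  assumes v: "3*pi/2 < v" "v < 5*pi/2" and q: "v - pi \<le> q" "q \<le> 5*pi/2" "q \<noteq> v"
  shows "height v (K q) > 0"
proof (cases "q < v")
  case True
  then have "Im (cis (-v) * (K v - K q)) < 0" using v q by (intro secant_right) auto
  then show ?thesis using height_diff[of v "K v" "K q"] by simp
next
  case False
  then show ?thesis unfolding height_def using v q by (intro secant_left) auto
qed

lemma height_axis_pos:
  assumes "y > 0" "K x = \<i> * of_real y" "height p 0 > 0" "cos p > 0"
  shows "height p (K x) > 0"
proof -
  have "height p (K x) = height p 0 + y * cos p" using assms(2) by (simp add: height_def algebra_simps)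
  then show ?thesis using assms by (simp add: add_pos_pos)
qed

text \<open>The crossing of the axis above the cusp separates the two halves of the outer arc, and each
  tangent line passes below the cusp.\<close>
lemma above_one_tangent:
  assumes u: "-pi/2 < u" "u < pi/2" and v: "3*pi/2 < v" "v < 5*pi/2"
    and q: "q \<in> {-pi/2..5*pi/2}" "q \<noteq> u" "q \<noteq> v"
  shows "height u (K q) > 0 \<or> height v (K q) > 0"
proof -
  consider "q \<le> u + pi" | "v - pi \<le> q" | "u + pi < q" "q < v - pi" by linarith
  then show ?thesis
  proof cases
    case 1
    then show ?thesis using height_right_tangent[OF u] q by simp
  next
    case 2
    then show ?thesis using height_left_tangent[OF v] q by simp
  next
    case 3
    obtain x y where x: "pi/2 < x" "x < 3*pi/2" "y > 0" "K x = \<i> * of_real y" by (rule axis_crossing)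
    show ?thesis
    proof (cases "q \<le> x")
      case True
      have "cos u > 0" using u by (intro cos_gt_zero_pi) auto
      moreover have "height u 0 > 0" using height_right_tangent[OF u, of "-pi/2"] u by simp
      ultimately have "height u (K x) > 0" using height_axis_pos x by blast
      moreover have "Im (cis (-u) * (K x - K q)) < 0" if "q < x"
        using u q x 3 that by (intro secant_right_cong[where d = "u + 2*pi"]) auto
      ultimately show ?thesis using True height_diff[of u "K x" "K q"] by (cases "q = x") auto
    next
      case False
      have "cos v = cos (v - 2*pi)" by (simp add: cos_diff)
      then have "cos v > 0" using v cos_gt_zero_pi[of "v - 2*pi"] by simp
      moreover have "height v 0 > 0" using height_left_tangent[OF v, of "5*pi/2"] v by simp
      ultimately have "height v (K x) > 0" using height_axis_pos x by blast
      moreover have "Im (cis (-v) * (K q - K x)) > 0"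
        using v q x 3 False by (intro secant_left_cong[where d = "v - 2*pi"]) auto
      ultimately show ?thesis using height_diff[of v "K q" "K x"] by simp
    qed
  qed
qed

end

section \<open>Copies of the cardioid resting on a concave arc\<close>

context concave_turning_arc
begin

lemma angle_decreasing: "t1 \<le> s \<Longrightarrow> s < t \<Longrightarrow> t \<le> t2 \<Longrightarrow> \<theta> t < \<theta> s"
  using monotone_onD[OF decreasing, of s t] by auto

lemma angle_antimono: "t1 \<le> s \<Longrightarrow> s \<le> t \<Longrightarrow> t \<le> t2 \<Longrightarrow> \<theta> t \<le> \<theta> s"
  using angle_decreasing[of s t] by (cases "s = t") auto

lemma turning_less_pi: "t1 \<le> s \<Longrightarrow> s \<le> t \<Longrightarrow> t \<le> t2 \<Longrightarrow> \<theta> s - \<theta> t < pi"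
  using total_turning angle_antimono[of t1 s] angle_antimono[of t t2] by linarith

lemma below_tangent:
  assumes "s \<in> {t1..t2}" "t \<in> {t1..t2}" "t \<noteq> s"
  shows "height s (g t) < 0"
proof (cases "s < t")
  case True
  then show ?thesis
    unfolding height_def using angle_decreasing[of s t] turning_less_pi[of s t] assms
    by (intro secant_right) auto
next
  case False
  then have "Im (cis (-\<theta> s) * (g s - g t)) > 0"
    using angle_decreasing[of t s] turning_less_pi[of t s] assms by (intro secant_left) auto
  then show ?thesis by (simp add: height_def algebra_simps)
qed

lemma height_arc_le: "s \<in> {t1..t2} \<Longrightarrow> t \<in> {t1..t2} \<Longrightarrow> height s (g t) \<le> 0"
  using below_tangent[of s t] by (cases "t = s") (auto simp: height_def)

lemma chord_angle:
  assumes "t1 \<le> s" "s < t" "t \<le> t2"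
  obtains b where "\<theta> t < b" "b < \<theta> s" "sgn (g t - g s) = cis b" "g t \<noteq> g s"
proof -
  obtain b where b: "min (\<theta> s) (\<theta> t) < b" "b < max (\<theta> s) (\<theta> t)" "sgn (g t - g s) = cis b"
    using secant_angle[OF assms] angle_decreasing[OF assms] turning_less_pi[of s t] assms by auto
  moreover have "g t \<noteq> g s" using b(3) by auto
  ultimately show thesis using that[of b] angle_decreasing[OF assms] by auto
qed

end

locale resting_cardioid = cardioid: cardioid_by_angle K + arc: concave_turning_arc g \<theta> t1 t2
  for K g \<theta> t1 t2
begin

definition tilts :: "real \<Rightarrow> real \<Rightarrow> real set" where
  "tilts s1 s2 = {\<theta> s1 - pi/2..\<theta> s2 + pi/2}"

definition gap :: "real \<Rightarrow> real \<Rightarrow> real \<Rightarrow> complex" where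
  "gap s1 s2 \<alpha> = K (\<theta> s2 - \<alpha>) - K (\<theta> s1 - \<alpha> + 2 * pi)"

text \<open>The copy rotated by \<open>\<alpha>\<close> has the right tangents at both feet; it fits if the segment joining the
  feet is parallel to the chord of the arc.\<close>
definition defect :: "real \<Rightarrow> real \<Rightarrow> real \<Rightarrow> real" where
  "defect s1 s2 \<alpha> = Im (cnj (g s2 - g s1) * cis \<alpha> * gap s1 s2 \<alpha>)"

lemma foot_angles:
  assumes "t1 \<le> s1" "s1 \<le> s2" "s2 \<le> t2" "\<alpha> \<in> tilts s1 s2"
  shows "\<theta> s2 - \<alpha> \<in> {-pi/2..pi/2}" "\<theta> s1 - \<alpha> + 2 * pi \<in> {3*pi/2..5*pi/2}"
  using arc.angle_antimono[of s1 s2] assms by (auto simp: tilts_def)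

lemma Re_gap_pos:
  assumes s: "t1 \<le> s1" "s1 \<le> s2" "s2 \<le> t2" and \<alpha>: "\<alpha> \<in> tilts s1 s2"
  shows "Re (gap s1 s2 \<alpha>) > 0"
proof -
  have right: "Re (K p) > 0 \<or> p = -pi/2 \<and> K p = 0" if "p \<in> {-pi/2..pi/2}" for p
    using cardioid.Re_right_foot_pos[of p] that by (cases "p = -pi/2") auto
  have left: "Re (K p) < 0 \<or> p = 5*pi/2 \<and> K p = 0" if "p \<in> {3*pi/2..5*pi/2}" for p
    using cardioid.Re_left_foot_neg[of p] cardioid.K_end that by (metis atLeastAtMost_iff less_eq_real_def)
  have "\<theta> s1 - \<theta> s2 < pi" using arc.turning_less_pi s by auto
  then show ?thesis
    using right[OF foot_angles(1)[OF s \<alpha>]] left[OF foot_angles(2)[OF s \<alpha>]] by (auto simp: gap_def)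
qed

lemma defect_eq:
  assumes "sgn (g s2 - g s1) = cis b"
  shows "defect s1 s2 \<alpha> = norm (g s2 - g s1) * Im (cis (-(b - \<alpha>)) * gap s1 s2 \<alpha>)"
proof -
  have "g s2 - g s1 = rcis (norm (g s2 - g s1)) b" by (rule sgn_eq_cis_imp_rcis[OF assms])
  then have "cnj (g s2 - g s1) * cis \<alpha> = cnj (rcis (norm (g s2 - g s1)) b) * rcis 1 \<alpha>"
    by (simp only: cis_rcis_eq)
  also have "\<dots> = rcis (norm (g s2 - g s1)) (-b) * rcis 1 \<alpha>"
    by (simp add: rcis_def cis_cnj)
  finally have "cnj (g s2 - g s1) * cis \<alpha> * gap s1 s2 \<alpha> =
      of_real (norm (g s2 - g s1)) * (cis (-(b - \<alpha>)) * gap s1 s2 \<alpha>)"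
    unfolding rcis_mult by (simp add: rcis_def)
  moreover have "Im (of_real r * z) = r * Im z" for r z by simp
  ultimately show ?thesis unfolding defect_def by (simp only:)
qed

lemma defect_sign_iff:
  assumes "sgn (g s2 - g s1) = cis b"
  shows "defect s1 s2 \<alpha> > 0 \<longleftrightarrow> Im (cis (-(b - \<alpha>)) * gap s1 s2 \<alpha>) > 0"
    and "defect s1 s2 \<alpha> < 0 \<longleftrightarrow> Im (cis (-(b - \<alpha>)) * gap s1 s2 \<alpha>) < 0"
proof -
  have "norm (g s2 - g s1) > 0" using assms by auto
  then show "defect s1 s2 \<alpha> > 0 \<longleftrightarrow> Im (cis (-(b - \<alpha>)) * gap s1 s2 \<alpha>) > 0"
    "defect s1 s2 \<alpha> < 0 \<longleftrightarrow> Im (cis (-(b - \<alpha>)) * gap s1 s2 \<alpha>) < 0"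
    unfolding defect_eq[OF assms] by (simp_all only: zero_less_mult_iff mult_less_0_iff) auto
qed

lemma sgn_gap:
  assumes s: "t1 \<le> s1" "s1 \<le> s2" "s2 \<le> t2" and \<alpha>: "\<alpha> \<in> tilts s1 s2" "defect s1 s2 \<alpha> = 0"
    and b: "\<theta> s2 < b" "b < \<theta> s1" "sgn (g s2 - g s1) = cis b"
  shows "sgn (gap s1 s2 \<alpha>) = cis (b - \<alpha>)"
proof -
  let ?G = "gap s1 s2 \<alpha>"
  have pos: "Re ?G > 0" by (rule Re_gap_pos[OF s \<alpha>(1)])
  then have sgn: "sgn ?G = cis (Arg ?G)" by (subst cis_Arg) auto
  have "norm (g s2 - g s1) \<noteq> 0" "norm ?G \<noteq> 0" using b(3) pos by auto
  then have "sin (Arg ?G - (b - \<alpha>)) = 0"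
    using \<alpha>(2) unfolding defect_eq[OF b(3)] sgn_eq_cis_imp_Im_rotated[OF sgn] by simp
  moreover have "\<bar>Arg ?G\<bar> < pi/2" using pos Arg_Re_pos by blast
  then have "\<bar>Arg ?G - (b - \<alpha>)\<bar> < pi" using \<alpha>(1) b by (auto simp: tilts_def abs_less_iff)
  ultimately have "Arg ?G - (b - \<alpha>) = 0"
    using sin_eq_0_pi[of "Arg ?G - (b - \<alpha>)"] by (simp add: abs_less_iff)
  then show ?thesis using sgn by simp
qed

lemma defect_at_ends:
  assumes s: "t1 \<le> s1" "s1 < s2" "s2 \<le> t2"
  shows "defect s1 s2 (\<theta> s2 + pi/2) > 0" "defect s1 s2 (\<theta> s1 - pi/2) < 0"
proof -
  obtain b where b: "\<theta> s2 < b" "b < \<theta> s1" "sgn (g s2 - g s1) = cis b"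
    using arc.chord_angle[OF s] by blast
  have turn: "\<theta> s1 - \<theta> s2 < pi" using arc.turning_less_pi s by auto
  have "gap s1 s2 (\<theta> s2 + pi/2) = K (5*pi/2) - K (\<theta> s1 - (\<theta> s2 + pi/2) + 2*pi)"
    by (simp add: gap_def)
  moreover have "Im (cis (-(b - (\<theta> s2 + pi/2))) * (K (5*pi/2) - K (\<theta> s1 - (\<theta> s2 + pi/2) + 2*pi))) > 0"
    using turn b by (intro cardioid.secant_left_cong[OF _ _ _ _ _ cis_add_2pi]) auto
  ultimately show "defect s1 s2 (\<theta> s2 + pi/2) > 0" by (simp only: defect_sign_iff[OF b(3)])
  have "gap s1 s2 (\<theta> s1 - pi/2) = K (\<theta> s2 - (\<theta> s1 - pi/2)) - K (-pi/2)"
    by (simp add: gap_def)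
  moreover have "Im (cis (-(b - (\<theta> s1 - pi/2))) * (K (\<theta> s2 - (\<theta> s1 - pi/2)) - K (-pi/2))) < 0"
    using turn b by (intro cardioid.secant_right) auto
  ultimately show "defect s1 s2 (\<theta> s1 - pi/2) < 0" by (simp only: defect_sign_iff[OF b(3)])
qed

lemma defect_near_zero:
  assumes s: "t1 \<le> s1" "s1 < s2" "s2 \<le> t2" and \<alpha>: "\<alpha> \<in> tilts s1 s2" "defect s1 s2 \<alpha> = 0"
    and b: "\<theta> s2 < b" "b < \<theta> s1" "sgn (g s2 - g s1) = cis b" and \<beta>: "\<beta> \<in> tilts s1 s2"
  shows "\<alpha> < \<beta> \<Longrightarrow> \<beta> \<le> \<alpha> + (b - \<theta> s2) \<Longrightarrow> defect s1 s2 \<beta> > 0"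
    and "\<beta> < \<alpha> \<Longrightarrow> \<alpha> \<le> \<beta> + (\<theta> s1 - b) \<Longrightarrow> defect s1 s2 \<beta> < 0"
proof -
  let ?e = "b - \<beta>"
  have turn: "\<theta> s1 - \<theta> s2 < pi" using arc.turning_less_pi s by auto
  have s': "s1 \<le> s2" using s by simp
  have "Im (cis (- ?e) * gap s1 s2 \<alpha>) = norm (gap s1 s2 \<alpha>) * sin ((b - \<alpha>) - ?e)"
    by (rule sgn_eq_cis_imp_Im_rotated[OF sgn_gap[OF s(1) s' s(3) \<alpha> b]])
  then have rotated: "Im (cis (- ?e) * gap s1 s2 \<alpha>) = norm (gap s1 s2 \<alpha>) * sin (\<beta> - \<alpha>)" by simp
  have gap: "norm (gap s1 s2 \<alpha>) > 0" using Re_gap_pos[OF s(1) s' s(3) \<alpha>(1)] by auto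
  {
    assume d: "\<alpha> < \<beta>" "\<beta> \<le> \<alpha> + (b - \<theta> s2)"
    have "sin (\<beta> - \<alpha>) > 0" using d b turn by (intro sin_gt_zero) auto
    then have "Im (cis (- ?e) * gap s1 s2 \<alpha>) > 0" unfolding rotated using gap by simp
    moreover have "Im (cis (- ?e) * (K (\<theta> s2 - \<alpha>) - K (\<theta> s2 - \<beta>))) < 0"
      using d b turn \<alpha> \<beta> by (intro cardioid.secant_right) (auto simp: tilts_def)
    moreover have "Im (cis (- ?e) * (K (\<theta> s1 - \<alpha> + 2*pi) - K (\<theta> s1 - \<beta> + 2*pi))) > 0"
      using d b turn \<alpha> \<beta>
      by (intro cardioid.secant_left_cong[OF _ _ _ _ _ cis_add_2pi]) (auto simp: tilts_def)
    ultimately have "Im (cis (- ?e) * gap s1 s2 \<beta>) > 0"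
      unfolding gap_def right_diff_distrib minus_complex.sel by linarith
    then show "defect s1 s2 \<beta> > 0" unfolding defect_sign_iff[OF b(3)] .
  next
    assume d: "\<beta> < \<alpha>" "\<alpha> \<le> \<beta> + (\<theta> s1 - b)"
    have "sin (\<alpha> - \<beta>) > 0" using d b turn by (intro sin_gt_zero) auto
    then have "sin (\<beta> - \<alpha>) < 0" using sin_minus[of "\<alpha> - \<beta>"] by simp
    then have "Im (cis (- ?e) * gap s1 s2 \<alpha>) < 0" unfolding rotated using gap by (simp add: mult_pos_neg)
    moreover have "Im (cis (- ?e) * (K (\<theta> s2 - \<beta>) - K (\<theta> s2 - \<alpha>))) < 0"
      using d b turn \<alpha> \<beta> by (intro cardioid.secant_right) (auto simp: tilts_def)
    moreover have "Im (cis (- ?e) * (K (\<theta> s1 - \<beta> + 2*pi) - K (\<theta> s1 - \<alpha> + 2*pi))) > 0"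
      using d b turn \<alpha> \<beta>
      by (intro cardioid.secant_left_cong[OF _ _ _ _ _ cis_add_2pi]) (auto simp: tilts_def)
    ultimately have "Im (cis (- ?e) * gap s1 s2 \<beta>) < 0"
      unfolding gap_def right_diff_distrib minus_complex.sel by linarith
    then show "defect s1 s2 \<beta> < 0" unfolding defect_sign_iff[OF b(3)] .
  }
qed

lemma defect_upcrossing:
  assumes s: "t1 \<le> s1" "s1 < s2" "s2 \<le> t2" and \<alpha>: "\<alpha> \<in> tilts s1 s2" "defect s1 s2 \<alpha> = 0"
  shows "(\<forall>\<^sub>F \<beta> in at_right \<alpha>. defect s1 s2 \<beta> > 0) \<and> (\<forall>\<^sub>F \<beta> in at_left \<alpha>. defect s1 s2 \<beta> < 0)"
proof
  obtain b where b: "\<theta> s2 < b" "b < \<theta> s1" "sgn (g s2 - g s1) = cis b"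
    using arc.chord_angle[OF s] by blast
  have interior: "\<theta> s1 - pi/2 < \<alpha>" "\<alpha> < \<theta> s2 + pi/2"
    using \<alpha> defect_at_ends[OF s] by (auto simp: less_le tilts_def)
  show "\<forall>\<^sub>F \<beta> in at_right \<alpha>. defect s1 s2 \<beta> > 0"
    unfolding eventually_at_right_field
  proof (intro exI[of _ "min (\<theta> s2 + pi/2) (\<alpha> + (b - \<theta> s2))"] conjI allI impI)
    fix \<beta> assume "\<alpha> < \<beta>" "\<beta> < min (\<theta> s2 + pi/2) (\<alpha> + (b - \<theta> s2))"
    then show "defect s1 s2 \<beta> > 0"
      using interior by (intro defect_near_zero(1)[OF s \<alpha> b]) (auto simp: tilts_def)
  qed (use interior b in auto)
  show "\<forall>\<^sub>F \<beta> in at_left \<alpha>. defect s1 s2 \<beta> < 0"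
    unfolding eventually_at_left_field
  proof (intro exI[of _ "max (\<theta> s1 - pi/2) (\<alpha> - (\<theta> s1 - b))"] conjI allI impI)
    fix \<beta> assume "max (\<theta> s1 - pi/2) (\<alpha> - (\<theta> s1 - b)) < \<beta>" "\<beta> < \<alpha>"
    then show "defect s1 s2 \<beta> < 0"
      using interior by (intro defect_near_zero(2)[OF s \<alpha> b]) (auto simp: tilts_def)
  qed (use interior b in auto)
qed

end

context resting_cardioid
begin

definition pairs :: "(real \<times> real) set" where
  "pairs = {(s1, s2). t1 \<le> s1 \<and> s1 \<le> s2 \<and> s2 \<le> t2}"

definition proper_pairs :: "(real \<times> real) set" where
  "proper_pairs = {(s1, s2). t1 \<le> s1 \<and> s1 < s2 \<and> s2 \<le> t2}"

text \<open>On the diagonal \<open>tilt\<close> is arbitrary, but \<open>factor\<close> vanishes there, so \<open>place\<close> is constant.\<close>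
definition tilt :: "real \<times> real \<Rightarrow> real" where
  "tilt z = (THE \<alpha>. \<alpha> \<in> tilts (fst z) (snd z) \<and> defect (fst z) (snd z) \<alpha> = 0)"

definition right_foot :: "real \<times> real \<Rightarrow> real" where
  "right_foot z = \<theta> (snd z) - tilt z"

definition left_foot :: "real \<times> real \<Rightarrow> real" where
  "left_foot z = \<theta> (fst z) - tilt z + 2 * pi"

definition factor :: "real \<times> real \<Rightarrow> complex" where
  "factor z = (g (snd z) - g (fst z)) / gap (fst z) (snd z) (tilt z)"

definition offset :: "real \<times> real \<Rightarrow> complex" where
  "offset z = g (fst z) - factor z * K (left_foot z)"

definition place :: "real \<times> real \<Rightarrow> real \<Rightarrow> complex" where
  "place z p = factor z * K p + offset z"

lemma compact_pairs: "compact pairs" and convex_pairs: "convex pairs"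
proof -
  have eq: "pairs = {z. inner (-1, 0) z \<le> -t1} \<inter> {z. inner (1, -1) z \<le> 0} \<inter> {z. inner (0, 1) z \<le> t2}"
    by (auto simp: inner_prod_def pairs_def)
  show "convex pairs" unfolding eq by (intro convex_Int convex_halfspace_le)
  have "closed pairs" unfolding eq by (intro closed_Int closed_halfspace_le)
  moreover have "pairs \<subseteq> {t1..t2} \<times> {t1..t2}" by (auto simp: pairs_def)
  then have "bounded pairs" by (rule bounded_subset[rotated]) (auto intro!: bounded_Times)
  ultimately show "compact pairs" by (simp add: compact_eq_bounded_closed)
qed

lemma pairs_cases:
  assumes "z \<in> pairs"
  obtains (proper) s1 s2 where "z = (s1, s2)" "z \<in> proper_pairs" "t1 \<le> s1" "s1 < s2" "s2 \<le> t2"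
  | (diagonal) s where "z = (s, s)" "t1 \<le> s" "s \<le> t2"
  using assms by (auto simp: pairs_def proper_pairs_def less_le)

lemma proper_pairs_subset: "proper_pairs \<subseteq> pairs"
  by (auto simp: pairs_def proper_pairs_def)

lemma openin_proper_pairs: "openin (top_of_set pairs) proper_pairs"
proof -
  have "open {z::real \<times> real. fst z < snd z}" by (intro open_Collect_less continuous_intros)
  moreover have "proper_pairs = pairs \<inter> {z. fst z < snd z}" by (auto simp: pairs_def proper_pairs_def)
  ultimately show ?thesis by (simp add: openin_open_Int)
qed

lemma continuous_on_pairs:
  "continuous_on pairs (\<lambda>z. g (fst z))" "continuous_on pairs (\<lambda>z. g (snd z))"
  "continuous_on pairs (\<lambda>z. \<theta> (fst z))" "continuous_on pairs (\<lambda>z. \<theta> (snd z))"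
  by (auto intro!: continuous_on_compose2[OF arc.continuous_curve]
      continuous_on_compose2[OF arc.continuous_angle]
      continuous_intros simp: pairs_def)

definition band :: "((real \<times> real) \<times> real) set" where
  "band = {(z, \<alpha>). z \<in> pairs \<and> \<alpha> \<in> tilts (fst z) (snd z)}"

lemma tilts_subset: "z \<in> pairs \<Longrightarrow> tilts (fst z) (snd z) \<subseteq> {\<theta> t2 - pi/2..\<theta> t1 + pi/2}"
  using arc.angle_antimono[of "fst z" t2] arc.angle_antimono[of t1 "snd z"]
    arc.angle_antimono[of t1 "fst z"] arc.angle_antimono[of "snd z" t2]
  by (auto simp: tilts_def pairs_def)

lemma compact_band: "compact band"
proof -
  let ?B = "pairs \<times> {\<theta> t2 - pi/2..\<theta> t1 + pi/2}"
  have B: "compact ?B" using compact_pairs by (intro compact_Times) auto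
  have angles: "continuous_on ?B (\<lambda>x. \<theta> (fst (fst x)))" "continuous_on ?B (\<lambda>x. \<theta> (snd (fst x)))"
    by (rule continuous_on_compose2[OF continuous_on_pairs(3)]
        continuous_on_compose2[OF continuous_on_pairs(4)];
        auto intro!: continuous_intros)+
  have preimage: "closed (?B \<inter> f -` {0..})" if "continuous_on ?B f" for f :: "_ \<Rightarrow> real"
    by (rule continuous_closed_preimage[OF that compact_imp_closed[OF B] closed_atLeast])
  have halves: "closed (?B \<inter> (\<lambda>x. snd x - \<theta> (fst (fst x)) + pi/2) -` {0..})"
    "closed (?B \<inter> (\<lambda>x. \<theta> (snd (fst x)) + pi/2 - snd x) -` {0..})"
    by (intro preimage continuous_intros angles)+
  have "band = ?B \<inter> (?B \<inter> (\<lambda>x. snd x - \<theta> (fst (fst x)) + pi/2) -` {0..}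
      \<inter> (?B \<inter> (\<lambda>x. \<theta> (snd (fst x)) + pi/2 - snd x) -` {0..}))"
    using tilts_subset by (auto simp: band_def tilts_def subset_iff)
  then show ?thesis using compact_Int_closed[OF B closed_Int[OF halves]] by simp
qed

lemma continuous_on_band:
  "continuous_on band (\<lambda>x. g (fst (fst x)))" "continuous_on band (\<lambda>x. g (snd (fst x)))"
  "continuous_on band (\<lambda>x. gap (fst (fst x)) (snd (fst x)) (snd x))"
proof -
  have base: "continuous_on band (\<lambda>x. f (fst x))" if "continuous_on pairs f"
    for f :: "real \<times> real \<Rightarrow> 'a::topological_space"
    by (rule continuous_on_compose2[OF that]) (auto intro!: continuous_intros simp: band_def)
  show "continuous_on band (\<lambda>x. g (fst (fst x)))" "continuous_on band (\<lambda>x. g (snd (fst x)))"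
    by (rule base[OF continuous_on_pairs(1)] base[OF continuous_on_pairs(2)])+
  have right: "continuous_on band (\<lambda>x. \<theta> (snd (fst x)) - snd x)"
    and left: "continuous_on band (\<lambda>x. \<theta> (fst (fst x)) - snd x + 2 * pi)"
    by (intro continuous_intros base[OF continuous_on_pairs(3)] base[OF continuous_on_pairs(4)])+
  have "\<theta> (snd (fst x)) - snd x \<in> {-pi/2..5*pi/2}"
    "\<theta> (fst (fst x)) - snd x + 2 * pi \<in> {-pi/2..5*pi/2}" if "x \<in> band" for x
    using foot_angles[of "fst (fst x)" "snd (fst x)" "snd x"] that by (auto simp: band_def pairs_def)
  then show "continuous_on band (\<lambda>x. gap (fst (fst x)) (snd (fst x)) (snd x))"
    unfolding gap_def
    by (intro continuous_on_diff continuous_on_compose2[OF cardioid.continuous_curve right]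
        continuous_on_compose2[OF cardioid.continuous_curve left]) blast+
qed

lemma continuous_defect_on_band: "continuous_on band (\<lambda>x. defect (fst (fst x)) (snd (fst x)) (snd x))"
  unfolding defect_def by (intro continuous_intros continuous_on_band)

lemma continuous_defect:
  assumes "(s1, s2) \<in> pairs"
  shows "continuous_on (tilts s1 s2) (defect s1 s2)"
proof -
  have pair: "continuous_on (tilts s1 s2) (\<lambda>\<alpha>. ((s1, s2), \<alpha>))" by (intro continuous_intros)
  have "(\<lambda>\<alpha>. ((s1, s2), \<alpha>)) ` tilts s1 s2 \<subseteq> band" using assms by (auto simp: band_def)
  from continuous_on_compose2[OF continuous_defect_on_band pair this] show ?thesis by simp
qed

lemma fitting_tilt_unique:
  assumes s: "t1 \<le> s1" "s1 < s2" "s2 \<le> t2"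
    and "\<alpha> \<in> tilts s1 s2" "defect s1 s2 \<alpha> = 0" "\<beta> \<in> tilts s1 s2" "defect s1 s2 \<beta> = 0"
  shows "\<alpha> = \<beta>"
proof (rule upcrossing_zero_unique)
  show "continuous_on {\<theta> s1 - pi/2..\<theta> s2 + pi/2} (defect s1 s2)"
    using continuous_defect[of s1 s2] s by (simp add: pairs_def tilts_def)
qed (use assms defect_upcrossing[OF s] in \<open>auto simp: tilts_def\<close>)

lemma tilt_fits:
  assumes s: "t1 \<le> s1" "s1 < s2" "s2 \<le> t2"
  shows "tilt (s1, s2) \<in> tilts s1 s2" "defect s1 s2 (tilt (s1, s2)) = 0"
proof -
  have "\<theta> s1 - pi/2 \<le> \<theta> s2 + pi/2" using arc.turning_less_pi[of s1 s2] s by auto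
  then have "\<exists>\<alpha>\<ge>\<theta> s1 - pi/2. \<alpha> \<le> \<theta> s2 + pi/2 \<and> defect s1 s2 \<alpha> = 0"
    using defect_at_ends[OF s] continuous_defect[of s1 s2] s
    by (intro IVT') (auto simp: pairs_def tilts_def)
  then have "\<exists>!\<alpha>. \<alpha> \<in> tilts s1 s2 \<and> defect s1 s2 \<alpha> = 0"
    using fitting_tilt_unique[OF s] unfolding tilts_def by (metis atLeastAtMost_iff)
  from theI'[OF this] show "tilt (s1, s2) \<in> tilts s1 s2" "defect s1 s2 (tilt (s1, s2)) = 0"
    unfolding tilt_def by simp_all
qed

lemma tilt_bounds:
  assumes "t1 \<le> s1" "s1 < s2" "s2 \<le> t2"
  shows "\<theta> s1 - pi/2 < tilt (s1, s2)" "tilt (s1, s2) < \<theta> s2 + pi/2"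
  using tilt_fits[OF assms] defect_at_ends[OF assms] by (auto simp: tilts_def less_le)

lemma feet_bounds:
  assumes "t1 \<le> s1" "s1 < s2" "s2 \<le> t2"
  shows "-pi/2 < right_foot (s1, s2)" "right_foot (s1, s2) < pi/2"
    "3*pi/2 < left_foot (s1, s2)" "left_foot (s1, s2) < 5*pi/2"
  using tilt_bounds[OF assms] arc.angle_decreasing[OF assms] by (auto simp: right_foot_def left_foot_def)

lemma continuous_on_tilt: "continuous_on proper_pairs tilt"
proof -
  let ?T = "{\<theta> t2 - pi/2..\<theta> t1 + pi/2}"
  let ?zeros = "band \<inter> (\<lambda>x. defect (fst (fst x)) (snd (fst x)) (snd x)) -` {0}"
  have "closed ?zeros"
    by (intro continuous_closed_preimage continuous_defect_on_band compact_imp_closed compact_band) auto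
  moreover have tilt_pairs: "tilt z \<in> tilts (fst z) (snd z)" "defect (fst z) (snd z) (tilt z) = 0"
    if "z \<in> proper_pairs" for z
    using tilt_fits[of "fst z" "snd z"] that by (auto simp: proper_pairs_def)
  have "(\<lambda>z. (z, tilt z)) ` proper_pairs = (proper_pairs \<times> ?T) \<inter> ?zeros"
  proof (intro equalityI subsetI)
    fix x assume "x \<in> (\<lambda>z. (z, tilt z)) ` proper_pairs"
    then show "x \<in> (proper_pairs \<times> ?T) \<inter> ?zeros"
      using tilt_pairs tilts_subset proper_pairs_subset by (fastforce simp: band_def)
  next
    fix x assume x: "x \<in> (proper_pairs \<times> ?T) \<inter> ?zeros"
    then have "snd x = tilt (fst x)"
      using fitting_tilt_unique[of "fst (fst x)" "snd (fst x)" "snd x" "tilt (fst x)"]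
        tilt_pairs[of "fst x"]
      by (auto simp: band_def proper_pairs_def)
    then show "x \<in> (\<lambda>z. (z, tilt z)) ` proper_pairs" using x by (auto intro: rev_image_eqI[of "fst x"])
  qed
  ultimately have "closedin (top_of_set (proper_pairs \<times> ?T)) ((\<lambda>z. (z, tilt z)) ` proper_pairs)"
    by (simp add: closedin_closed_Int)
  moreover have "tilt \<in> proper_pairs \<rightarrow> ?T" using tilt_pairs(1) tilts_subset proper_pairs_subset by blast
  ultimately show ?thesis using continuous_closed_graph_eq[of ?T tilt proper_pairs] by simp
qed

lemma sgn_gap_tilt:
  assumes s: "t1 \<le> s1" "s1 < s2" "s2 \<le> t2"
  shows "sgn (gap s1 s2 (tilt (s1, s2))) * cis (tilt (s1, s2)) = sgn (g s2 - g s1)"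
proof -
  obtain b where b: "\<theta> s2 < b" "b < \<theta> s1" "sgn (g s2 - g s1) = cis b"
    using arc.chord_angle[OF s] by blast
  then have "sgn (gap s1 s2 (tilt (s1, s2))) = cis (b - tilt (s1, s2))"
    using s by (intro sgn_gap tilt_fits b) auto
  then show ?thesis unfolding b(3) by (simp add: cis_mult)
qed

lemma sgn_factor:
  assumes s: "t1 \<le> s1" "s1 < s2" "s2 \<le> t2"
  shows "sgn (factor (s1, s2)) = cis (tilt (s1, s2))"
proof -
  have "gap s1 s2 (tilt (s1, s2)) \<noteq> 0" using Re_gap_pos[OF s(1) _ s(3) tilt_fits(1)[OF s]] s by auto
  moreover have "sgn (factor (s1, s2)) = sgn (g s2 - g s1) / sgn (gap s1 s2 (tilt (s1, s2)))"
    by (simp add: factor_def divide_inverse sgn_mult sgn_inverse)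
  ultimately show ?thesis
    using sgn_gap_tilt[OF s] by (simp add: sgn_zero_iff nonzero_divide_eq_eq mult.commute)
qed

lemma factor_nonzero: "t1 \<le> s1 \<Longrightarrow> s1 < s2 \<Longrightarrow> s2 \<le> t2 \<Longrightarrow> factor (s1, s2) \<noteq> 0"
  using sgn_factor[of s1 s2] by auto

lemma place_feet:
  assumes "t1 \<le> s1" "s1 < s2" "s2 \<le> t2"
  shows "place (s1, s2) (right_foot (s1, s2)) = g s2" "place (s1, s2) (left_foot (s1, s2)) = g s1"
proof -
  have "factor (s1, s2) * (K (right_foot (s1, s2)) - K (left_foot (s1, s2))) = g s2 - g s1"
    using factor_nonzero[OF assms]
    by (auto simp: factor_def right_foot_def left_foot_def simp flip: gap_def)
  then show "place (s1, s2) (right_foot (s1, s2)) = g s2" "place (s1, s2) (left_foot (s1, s2)) = g s1"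
    by (simp_all add: place_def offset_def algebra_simps)
qed

lemma place_diagonal: "place (s, s) p = g s"
  by (simp add: place_def factor_def offset_def)

lemma place_heights:
  assumes s: "t1 \<le> s1" "s1 < s2" "s2 \<le> t2"
  shows "arc.height s2 (place (s1, s2) p) =
      norm (factor (s1, s2)) * cardioid.height (right_foot (s1, s2)) (K p)"
    "arc.height s1 (place (s1, s2) p) = norm (factor (s1, s2)) * cardioid.height (left_foot (s1, s2)) (K p)"
proof -
  let ?z = "(s1, s2)"
  have rotate: "Im (cis (-e) * (factor ?z * w)) = norm (factor ?z) * Im (cis (-(e - tilt ?z)) * w)" for e w
  proof -
    have "cis (-e) * factor ?z = rcis 1 (-e) * rcis (norm (factor ?z)) (tilt ?z)"
      using sgn_eq_cis_imp_rcis[OF sgn_factor[OF s]] by (simp add: cis_rcis_eq)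
    also have "\<dots> = rcis (norm (factor ?z)) (-(e - tilt ?z))" by (simp add: rcis_mult)
    finally have "cis (-e) * (factor ?z * w) = of_real (norm (factor ?z)) * (cis (-(e - tilt ?z)) * w)"
      by (simp add: rcis_def flip: mult.assoc)
    moreover have "Im (of_real r * y) = r * Im y" for r y by simp
    ultimately show ?thesis by (simp only:)
  qed
  have diff: "place ?z p - place ?z q = factor ?z * (K p - K q)" for q
    by (simp add: place_def algebra_simps)
  show "arc.height s2 (place ?z p) = norm (factor ?z) * cardioid.height (right_foot ?z) (K p)"
    unfolding arc.height_def cardioid.height_def place_feet(1)[OF s, symmetric] diff rotate
    by (simp add: right_foot_def)
  have "cis (-(left_foot ?z)) = cis (-(\<theta> s1 - tilt ?z))"
    using cis_add_2pi[of "\<theta> s1 - tilt ?z"] by (simp add: left_foot_def flip: cis_inverse)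
  then show "arc.height s1 (place ?z p) = norm (factor ?z) * cardioid.height (left_foot ?z) (K p)"
    unfolding arc.height_def cardioid.height_def place_feet(2)[OF s, symmetric] diff rotate by simp
qed

lemma place_above_one_tangent:
  assumes s: "t1 \<le> s1" "s1 < s2" "s2 \<le> t2"
    and q: "q \<in> {-pi/2..5*pi/2}" "q \<noteq> right_foot (s1, s2)" "q \<noteq> left_foot (s1, s2)"
  shows "arc.height s1 (place (s1, s2) q) > 0 \<or> arc.height s2 (place (s1, s2) q) > 0"
  using cardioid.above_one_tangent[OF feet_bounds[OF s] q] factor_nonzero[OF s]
  unfolding place_heights[OF s] by (auto simp: zero_less_mult_iff)

lemma place_meets_arc_at_feet:
  assumes s: "t1 \<le> s1" "s1 < s2" "s2 \<le> t2"
    and q: "q \<in> {-pi/2..5*pi/2}" "place (s1, s2) q \<in> g ` {t1..t2}"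
  shows "q = right_foot (s1, s2) \<or> q = left_foot (s1, s2)"
proof -
  obtain t where t: "t \<in> {t1..t2}" "place (s1, s2) q = g t" using q by auto
  then have "arc.height s1 (place (s1, s2) q) \<le> 0" "arc.height s2 (place (s1, s2) q) \<le> 0"
    using arc.height_arc_le s by auto
  then show ?thesis using place_above_one_tangent[OF s q(1)] by force
qed

lemma factor_le_chord:
  obtains m where "m > 0" "\<And>z. z \<in> pairs \<Longrightarrow> norm (factor z) \<le> norm (g (snd z) - g (fst z)) / m"
proof -
  let ?gap = "\<lambda>x. gap (fst (fst x)) (snd (fst x)) (snd x)"
  have on_band: "(z, tilt z) \<in> band" if "z \<in> proper_pairs" for z
    using tilt_fits(1)[of "fst z" "snd z"] that by (auto simp: band_def proper_pairs_def pairs_def)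
  have "(t1, t2) \<in> proper_pairs" using arc.a_less_b by (simp add: proper_pairs_def)
  then have "band \<noteq> {}" using on_band by blast
  moreover have "continuous_on band (\<lambda>x. norm (?gap x))" by (intro continuous_on_norm continuous_on_band)
  ultimately obtain x where x: "x \<in> band" "\<And>y. y \<in> band \<Longrightarrow> norm (?gap x) \<le> norm (?gap y)"
    using continuous_attains_inf[OF compact_band] by blast
  have "Re (?gap x) > 0" using x(1) by (intro Re_gap_pos) (auto simp: band_def pairs_def)
  then have pos: "norm (?gap x) > 0" by auto
  have "norm (factor z) \<le> norm (g (snd z) - g (fst z)) / norm (?gap x)" if "z \<in> pairs" for z
    using that
  proof (cases rule: pairs_cases)
    case (proper s1 s2)
    have "norm (?gap x) \<le> norm (gap (fst z) (snd z) (tilt z))"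
      using x(2)[OF on_band[OF proper(2)]] by simp
    then show ?thesis unfolding factor_def norm_divide using pos by (intro frac_le) simp_all
  qed (simp add: factor_def)
  with pos show thesis by (rule that)
qed

lemma continuous_on_proper_pairs:
  "continuous_on proper_pairs factor" "continuous_on proper_pairs offset"
proof -
  note sub = continuous_on_subset[OF _ proper_pairs_subset]
  have graph: "continuous_on proper_pairs (\<lambda>z. (z, tilt z))"
    by (intro continuous_intros continuous_on_tilt)
  have "(\<lambda>z. (z, tilt z)) ` proper_pairs \<subseteq> band"
    using tilt_fits(1) by (auto simp: band_def proper_pairs_def pairs_def)
  from continuous_on_compose2[OF continuous_on_band(3) graph this]
  have "continuous_on proper_pairs (\<lambda>z. gap (fst z) (snd z) (tilt z))" by simp
  moreover have "gap (fst z) (snd z) (tilt z) \<noteq> 0" if "z \<in> proper_pairs" for z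
    using Re_gap_pos[of "fst z" "snd z" "tilt z"] tilt_fits(1)[of "fst z" "snd z"] that
    by (auto simp: proper_pairs_def)
  ultimately show factor: "continuous_on proper_pairs factor"
    unfolding factor_def
    by (intro continuous_intros sub[OF continuous_on_pairs(1)] sub[OF continuous_on_pairs(2)]) auto
  have "left_foot z \<in> {-pi/2..5*pi/2}" if "z \<in> proper_pairs" for z
    using feet_bounds(3,4)[of "fst z" "snd z"] that by (auto simp: proper_pairs_def)
  moreover have "continuous_on proper_pairs left_foot"
    unfolding left_foot_def by (intro continuous_intros continuous_on_tilt sub[OF continuous_on_pairs(3)])
  ultimately have "continuous_on proper_pairs (\<lambda>z. K (left_foot z))"
    by (intro continuous_on_compose2[OF cardioid.continuous_curve]) auto
  then show "continuous_on proper_pairs offset"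
    unfolding offset_def by (intro continuous_intros factor sub[OF continuous_on_pairs(1)])
qed

lemma continuous_at_diagonal:
  assumes s: "t1 \<le> s" "s \<le> t2"
  shows "continuous (at (s, s) within pairs) factor" "continuous (at (s, s) within pairs) offset"
proof -
  let ?F = "at (s, s) within pairs"
  have "(s, s) \<in> pairs" using s by (simp add: pairs_def)
  then have g: "((\<lambda>z. g (fst z)) \<longlongrightarrow> g s) ?F" "((\<lambda>z. g (snd z)) \<longlongrightarrow> g s) ?F"
    using continuous_on_pairs(1,2) by (force simp: continuous_on_def)+
  obtain m where m: "m > 0" "\<And>z. z \<in> pairs \<Longrightarrow> norm (factor z) \<le> norm (g (snd z) - g (fst z)) / m"
    using factor_le_chord by blast
  have "((\<lambda>z. norm (g (snd z) - g (fst z)) / m) \<longlongrightarrow> norm (g s - g s) / m) ?F"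
    using m(1) by (intro tendsto_intros g) simp
  then have chord: "((\<lambda>z. norm (g (snd z) - g (fst z)) / m) \<longlongrightarrow> 0) ?F" by simp
  have factor: "(factor \<longlongrightarrow> 0) ?F"
    by (rule Lim_null_comparison[OF _ chord]) (use m(2) in \<open>auto simp: eventually_at_filter\<close>)
  have "bounded (K ` {-pi/2..5*pi/2})"
    by (intro compact_imp_bounded compact_continuous_image cardioid.continuous_curve) auto
  then obtain B where B: "\<And>p. p \<in> {-pi/2..5*pi/2} \<Longrightarrow> norm (K p) \<le> B" unfolding bounded_iff by blast
  have "norm (factor z * K (left_foot z)) \<le> norm (factor z) * B" if "z \<in> pairs" for z
    using that
  proof (cases rule: pairs_cases)
    case (proper s1 s2)
    then have "norm (K (left_foot z)) \<le> B" using feet_bounds(3,4)[of s1 s2] by (intro B) auto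
    then show ?thesis by (simp add: norm_mult mult_left_mono)
  qed (simp add: factor_def)
  then have ev: "\<forall>\<^sub>F z in ?F. norm (factor z * K (left_foot z)) \<le> norm (factor z) * B"
    by (simp add: eventually_at_filter)
  have "((\<lambda>z. norm (factor z) * B) \<longlongrightarrow> 0) ?F"
    using tendsto_mult[OF tendsto_norm[OF factor] tendsto_const[of B]] by simp
  then have "((\<lambda>z. factor z * K (left_foot z)) \<longlongrightarrow> 0) ?F" by (rule Lim_null_comparison[OF ev])
  then have "(offset \<longlongrightarrow> g s - 0) ?F" unfolding offset_def by (intro tendsto_diff g)
  with factor show "continuous (at (s, s) within pairs) factor" "continuous (at (s, s) within pairs) offset"
    unfolding continuous_within by (simp_all add: factor_def offset_def)
qed

lemma continuous_on_place: "continuous_on (pairs \<times> {-pi/2..5*pi/2}) (\<lambda>x. place (fst x) (snd x))"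
proof -
  have diagonal: "\<exists>s. z = (s, s) \<and> t1 \<le> s \<and> s \<le> t2" if "z \<in> pairs - proper_pairs" for z
    using that by (auto elim: pairs_cases)
  have "continuous_on pairs factor" "continuous_on pairs offset"
    using continuous_at_diagonal diagonal
    by (intro continuous_on_from_open_part[OF openin_proper_pairs] continuous_on_proper_pairs; blast)+
  moreover have "continuous_on (pairs \<times> {-pi/2..5*pi/2}) (\<lambda>x. f (fst x))"
    if "continuous_on pairs f" for f :: "_ \<Rightarrow> complex"
    by (rule continuous_on_compose2[OF that]) (auto intro!: continuous_intros)
  moreover have "continuous_on (pairs \<times> {-pi/2..5*pi/2}) (\<lambda>x. K (snd x))"
    by (rule continuous_on_compose2[OF cardioid.continuous_curve]) (auto intro!: continuous_intros)
  ultimately show ?thesis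
    unfolding place_def by (intro continuous_on_add continuous_on_mult) blast+
qed

end

section \<open>Inscribed positions\<close>

locale inscription = resting_cardioid K g \<theta> t1 t2 for K g \<theta> t1 t2 +
  fixes t3 :: real
  assumes jordan: "jordan_param g" and orient: "ccw g" and t2_less_t3: "t2 < t3" and t3_less_end: "t3 < t1 + 1"
begin

abbreviation T :: "complex set" where "T \<equiv> path_image g"
abbreviation side2 :: "complex set" where "side2 \<equiv> g ` {t2..t3}"
abbreviation side3 :: "complex set" where "side3 \<equiv> g ` {t3..t1 + 1}"
abbreviation I :: "real set" where "I \<equiv> {-pi/2..5*pi/2}"

lemma t1_less_t2: "t1 < t2"
  by (rule arc.a_less_b)

lemma T_eq_Un_sides: "T = g ` {t1..t2} \<union> side2 \<union> side3"
proof -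
  have "{t1..t1 + 1} = {t1..t2} \<union> {t2..t3} \<union> {t3..t1 + 1}" using t1_less_t2 t2_less_t3 t3_less_end by auto
  then show ?thesis unfolding jordan_param_image_period[OF jordan, of t1] by (simp only: image_Un)
qed

lemma compact_sides: "compact side2" "compact side3" "compact T"
  using jordan_param_continuous[OF jordan]
  by (auto intro!: compact_continuous_image compact_path_image jordan_param_loop(2)[OF jordan])

lemma frontier_inside_T: "frontier (inside T) = T"
  using Jordan_inside_outside[OF jordan_param_loop(1,3)[OF jordan]] by blast

lemma T_subset_closure_inside: "T \<subseteq> closure (inside T)"
  using frontier_inside_T by (metis closure_Un_frontier sup.cobounded2)

lemma open_inside_T: "open (inside T)"
  using compact_sides(3) by (simp add: open_inside compact_imp_closed)

lemma connected_subset_inside: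
  assumes "connected S" "S \<inter> T = {}" "x \<in> S" "x \<in> inside T"
  shows "S \<subseteq> inside T"
proof
  fix y assume "y \<in> S"
  then have "connected_component (- T) x y"
    using assms unfolding connected_component_def by (intro exI[of _ S]) auto
  then show "y \<in> inside T" using assms(4) inside_same_component by blast
qed

lemma arc_meets_side2:
  assumes "s \<in> {t1..t2}" "g s \<in> side2"
  shows "s = t2"
proof -
  obtain x where x: "x \<in> {t2..t3}" "g s = g x" using assms(2) by blast
  have "s = x" using jordan_param_inj[OF jordan x(2), of t1] x assms(1) t1_less_t2 t2_less_t3 t3_less_end by auto
  then show ?thesis using x assms(1) by auto
qed

lemma arc_meets_side3:
  assumes "s \<in> {t1..t2}" "g s \<in> side3"
  shows "s = t1"
proof -
  obtain x where x: "x \<in> {t3..t1 + 1}" "g s = g x" using assms(2) by blast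
  show ?thesis
  proof (cases "x = t1 + 1")
    case True
    then have "g s = g t1" using x jordan_param_add_1[OF jordan] by simp
    then show ?thesis using jordan_param_inj[OF jordan, of s t1 t1] assms(1) t1_less_t2 t2_less_t3 t3_less_end by auto
  next
    case False
    then show ?thesis using jordan_param_inj[OF jordan x(2), of t1] x assms(1) t1_less_t2 t2_less_t3 t3_less_end by auto
  qed
qed

lemma corners_on_sides: "g t2 \<in> side2" "g t1 \<in> side3"
  using t2_less_t3 t3_less_end jordan_param_add_1[OF jordan, of t1] by (auto intro: image_eqI[of _ _ "t1 + 1"])

lemma left_of_arc_inside:
  assumes s: "t1 < s" "s < t2"
  shows "\<forall>\<^sub>F \<sigma> in at_right 0. g s + cis (\<theta> s) * (\<i> * of_real \<sigma>) \<in> inside T"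
proof -
  have "isCont \<theta> s" using arc.continuous_angle s by (simp add: continuous_on_interior)
  then have lim: "(\<theta> \<longlongrightarrow> \<theta> s) (at_left s)" "(\<theta> \<longlongrightarrow> \<theta> s) (at_right s)"
    unfolding isCont_def filterlim_at_split by auto
  have "\<forall>\<^sub>F x in at_left s. x \<in> {t1<..<s} \<and> \<theta> x < \<theta> s + pi/2"
    using eventually_at_left_real[OF s(1)] order_tendstoD(2)[OF lim(1), of "\<theta> s + pi/2"]
    by (simp add: eventually_conj_iff)
  then obtain u where u: "t1 < u" "u < s" "\<theta> u < \<theta> s + pi/2"
    using eventually_happens trivial_limit_at_left_real by fastforce
  have "\<forall>\<^sub>F x in at_right s. x \<in> {s<..<t2} \<and> \<theta> x > \<theta> s - pi/2"
    using eventually_at_right_real[OF s(2)] order_tendstoD(1)[OF lim(2), of "\<theta> s - pi/2"]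
    by (simp add: eventually_conj_iff)
  then obtain v where v: "s < v" "v < t2" "\<theta> v > \<theta> s - pi/2"
    using eventually_happens trivial_limit_at_right_real by fastforce
  have rotate: "Im (cis (-(\<theta> s - pi/2)) * z) = Re (cis (-\<theta> s) * z)" for z
  proof -
    have "cis (-(\<theta> s - pi/2)) = cis (-\<theta> s) * cis (pi/2)" unfolding cis_mult by simp
    then show ?thesis by simp
  qed
  have ahead: "Re (cis (-\<theta> s) * (g y - g x)) > 0" if "u \<le> x" "x < y" "y \<le> v" "x = s \<or> y = s" for x y
    unfolding rotate[symmetric]
    using that u v arc.angle_antimono[of u x] arc.angle_antimono[of y v] arc.angle_decreasing[of x y]
    by (intro arc.secant_left) auto
  show ?thesis
  proof (rule ccw_left_side_inside[OF jordan orient u(2) v(1)])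
    show "v < u + 1" using u v t2_less_t3 t3_less_end by linarith
    show "Im (cis (-\<theta> s) * (g x - g s)) < 0" if "x \<in> {u..v}" "x \<noteq> s" for x
      using arc.below_tangent[of s x] that u v by (simp add: arc.height_def)
    have behind: "Re (cis (-\<theta> s) * (g x - g s)) < 0" if "u \<le> x" "x < s" for x
      using ahead[of x s] that v by (simp add: algebra_simps)
    then show "Re (cis (-\<theta> s) * (g u - g s)) < 0" using u by simp
    show "Re (cis (-\<theta> s) * (g v - g s)) > 0" using ahead[of s v] u v by simp
    show "Re (cis (-\<theta> s) * (g x - g s)) \<noteq> 0" if "x \<in> {u..v}" "x \<noteq> s" for x
      using ahead[of s x] behind[of x] that u by (cases "x < s") auto
  qed
qed

lemma half_ball_inside:
  assumes s: "t1 < s" "s < t2" and B: "g s \<in> ball w e" "ball w e \<inter> (side2 \<union> side3) = {}"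
    and x: "x \<in> ball w e" "arc.height s x > 0"
  shows "x \<in> inside T"
proof -
  define H where "H = ball w e \<inter> {z. arc.height s z > 0}"
  have "{z. arc.height s z > 0} = {z. inner (\<i> * cis (\<theta> s)) z > Im (cis (-\<theta> s) * g s)}"
    by (auto simp: arc.height_def inner_complex_def algebra_simps)
  then have "connected H"
    unfolding H_def by (intro convex_connected convex_Int) (simp_all add: convex_halfspace_gt)
  moreover have "H \<inter> T = {}"
    using arc.height_arc_le[of s] s B(2) unfolding H_def T_eq_Un_sides by force
  moreover obtain \<sigma> where \<sigma>: "0 < \<sigma>" "g s + cis (\<theta> s) * (\<i> * of_real \<sigma>) \<in> inside T \<inter> ball w e"
  proof -
    have "((\<lambda>\<sigma>. g s + cis (\<theta> s) * (\<i> * of_real \<sigma>)) \<longlongrightarrow> g s + cis (\<theta> s) * (\<i> * of_real 0)) (at_right 0)"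
      by (intro tendsto_intros)
    then have "\<forall>\<^sub>F \<sigma> in at_right 0. g s + cis (\<theta> s) * (\<i> * of_real \<sigma>) \<in> ball w e"
      by (rule topological_tendstoD) (use B(1) in simp_all)
    then have "\<forall>\<^sub>F \<sigma> in at_right 0. 0 < \<sigma> \<and> g s + cis (\<theta> s) * (\<i> * of_real \<sigma>) \<in> inside T \<inter> ball w e"
      using left_of_arc_inside[OF s] eventually_at_right_less[of "0::real"] by eventually_elim simp
    then show thesis using that eventually_happens trivial_limit_at_right_real by blast
  qed
  moreover have "arc.height s (g s + cis (\<theta> s) * (\<i> * of_real \<sigma>)) = \<sigma>"
    by (simp add: arc.height_def cis_mult flip: mult.assoc)
  then have "g s + cis (\<theta> s) * (\<i> * of_real \<sigma>) \<in> H" using \<sigma> by (simp add: H_def)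
  ultimately have "H \<subseteq> inside T" using connected_subset_inside by blast
  then show ?thesis using x by (auto simp: H_def)
qed

definition inscribed :: "(real \<times> real) set" where
  "inscribed = {z \<in> pairs. \<forall>q\<in>I. place z q \<in> closure (inside T)}"

definition touching :: "complex set \<Rightarrow> (real \<times> real) set" where
  "touching S = {z \<in> pairs. \<exists>q\<in>I. place z q \<in> S}"

lemma touchingI: "z \<in> pairs \<Longrightarrow> q \<in> I \<Longrightarrow> place z q \<in> S \<Longrightarrow> z \<in> touching S"
  by (auto simp: touching_def)

lemma closed_touching:
  assumes "compact S"
  shows "closed (touching S)"
proof -
  have box: "compact (pairs \<times> I)" by (intro compact_Times compact_pairs) auto
  let ?hits = "(pairs \<times> I) \<inter> (\<lambda>x. place (fst x) (snd x)) -` S"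
  have "closed ?hits"
    by (intro continuous_closed_preimage continuous_on_place compact_imp_closed box assms)
  then have "compact ?hits" using compact_Int_closed[OF box, of ?hits] by simp
  then have "compact (fst ` ?hits)" by (intro compact_continuous_image continuous_intros)
  moreover have "fst ` ?hits = touching S" by (force simp: touching_def)
  ultimately show ?thesis by (simp add: compact_imp_closed)
qed

lemma continuous_on_place_fixed: "q \<in> I \<Longrightarrow> continuous_on pairs (\<lambda>z. place z q)"
  by (rule continuous_on_compose2[OF continuous_on_place, of _ "\<lambda>z. (z, q)", simplified])
    (auto intro!: continuous_intros)

lemma closed_inscribed: "closed inscribed"
proof -
  have "inscribed = (\<Inter>q\<in>I. pairs \<inter> (\<lambda>z. place z q) -` closure (inside T))"
    using pi_gt_zero by (auto simp: inscribed_def intro!: exI[of _ 0])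
  moreover have "closed (\<Inter>q\<in>I. pairs \<inter> (\<lambda>z. place z q) -` closure (inside T))"
    by (intro closed_INT ballI continuous_closed_preimage continuous_on_place_fixed
        compact_imp_closed compact_pairs closed_closure)
  ultimately show ?thesis by (simp only:)
qed

lemma diagonal_inscribed: "s \<in> {t1..t2} \<Longrightarrow> (s, s) \<in> inscribed"
  using T_subset_closure_inside by (auto simp: inscribed_def pairs_def place_diagonal T_eq_Un_sides)

lemma feet_in_I:
  assumes "t1 \<le> s1" "s1 < s2" "s2 \<le> t2"
  shows "right_foot (s1, s2) \<in> I" "left_foot (s1, s2) \<in> I"
  using feet_bounds[OF assms] by auto

lemma place_hits_contacts:
  assumes "(s1, s2) \<in> pairs"
  shows "\<exists>q\<in>I. place (s1, s2) q = g s1" "\<exists>q\<in>I. place (s1, s2) q = g s2"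
  using assms
proof (atomize (full), cases rule: pairs_cases)
  case (proper x y)
  then show "(\<exists>q\<in>I. place (s1, s2) q = g s1) \<and> (\<exists>q\<in>I. place (s1, s2) q = g s2)"
    using place_feet[of s1 s2] feet_in_I[of s1 s2] by auto
next
  case (diagonal s)
  then show "(\<exists>q\<in>I. place (s1, s2) q = g s1) \<and> (\<exists>q\<in>I. place (s1, s2) q = g s2)"
    using pi_gt_zero by (auto simp: place_diagonal intro!: bexI[of _ pi])
qed

lemma cusp_and_apex_not_feet:
  assumes "t1 \<le> s1" "s1 < s2" "s2 \<le> t2" "q = -pi/2 \<or> q = pi"
  shows "q \<in> I" "q \<noteq> right_foot (s1, s2)" "q \<noteq> left_foot (s1, s2)"
  using feet_bounds[OF assms(1-3)] assms(4) pi_gt_zero by auto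

lemma place_avoids_T:
  assumes s: "t1 \<le> s1" "s1 < s2" "s2 \<le> t2" and "(s1, s2) \<notin> touching side2 \<union> touching side3"
    and q: "q \<in> I" "q \<noteq> right_foot (s1, s2)" "q \<noteq> left_foot (s1, s2)"
  shows "place (s1, s2) q \<notin> T"
proof -
  have "(s1, s2) \<in> pairs" using s by (simp add: pairs_def)
  then show ?thesis
    using place_meets_arc_at_feet[OF s q(1)] q assms(4) by (auto simp: T_eq_Un_sides touching_def)
qed

text \<open>The feet cut the copy into two arcs, one containing the cusp and one containing the point with
  parameter \<open>pi\<close>.\<close>
lemma inscribed_if_cusp_and_apex_inside:
  assumes s: "t1 \<le> s1" "s1 < s2" "s2 \<le> t2" and free: "(s1, s2) \<notin> touching side2 \<union> touching side3"
    and inside: "place (s1, s2) (-pi/2) \<in> inside T" "place (s1, s2) pi \<in> inside T"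
  shows "(s1, s2) \<in> inscribed"
proof -
  let ?z = "(s1, s2)"
  note feet = feet_bounds[OF s]
  have arc_inside: "place ?z ` J \<subseteq> inside T"
    if J: "connected J" "J \<subseteq> I - {right_foot ?z, left_foot ?z}" "p \<in> J" "place ?z p \<in> inside T" for J p
  proof (rule connected_subset_inside)
    have "continuous_on I (place ?z)"
      unfolding place_def by (intro continuous_intros cardioid.continuous_curve)
    then show "connected (place ?z ` J)"
      using J by (intro connected_continuous_image continuous_on_subset[of I "place ?z" J]) auto
    show "place ?z ` J \<inter> T = {}" using place_avoids_T[OF s free] J(2) by blast
  qed (use J in auto)
  have "K (5*pi/2) = K (-pi/2)" by simp
  then have cusp: "place ?z (5*pi/2) \<in> inside T" using inside(1) by (simp only: place_def)
  have "place ?z ` {-pi/2..<right_foot ?z} \<subseteq> inside T"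
    by (rule arc_inside[of _ "-pi/2"]) (use inside feet in auto)
  moreover have "place ?z ` {right_foot ?z<..<left_foot ?z} \<subseteq> inside T"
    by (rule arc_inside[of _ pi]) (use inside feet pi_gt_zero in auto)
  moreover have "place ?z ` {left_foot ?z<..5*pi/2} \<subseteq> inside T"
    by (rule arc_inside[of _ "5*pi/2"]) (use cusp feet in auto)
  ultimately have arcs: "place ?z q \<in> inside T"
    if "q \<in> {-pi/2..<right_foot ?z} \<union> {right_foot ?z<..<left_foot ?z} \<union> {left_foot ?z<..5*pi/2}" for q
    using that by blast
  have "place ?z q \<in> closure (inside T)" if q: "q \<in> I" for q
  proof (cases "q = right_foot ?z \<or> q = left_foot ?z")
    case True
    then have "place ?z q \<in> T" using place_feet[OF s] s by (auto simp: T_eq_Un_sides)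
    then show ?thesis using T_subset_closure_inside by blast
  next
    case False
    then have "place ?z q \<in> inside T" using q by (intro arcs) auto
    then show ?thesis using closure_subset by blast
  qed
  then show ?thesis using s by (simp add: inscribed_def pairs_def)
qed

lemma place_tendsto: "q \<in> I \<Longrightarrow> z \<in> pairs \<Longrightarrow> ((\<lambda>w. place w q) \<longlongrightarrow> place z q) (at z within pairs)"
  using continuous_on_place_fixed[of q] by (auto simp: continuous_on_def)

lemma cusp_and_apex_in_I: "-pi/2 \<in> I" "pi \<in> I"
  using pi_gt_zero unfolding atLeastAtMost_iff by (intro conjI; linarith)+

lemma eventually_in_pairs: "\<forall>\<^sub>F w in at z within pairs. w \<in> pairs"
  by (simp add: eventually_at_filter)

lemma eventually_not_touching:
  assumes "z \<notin> touching side2 \<union> touching side3"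
  shows "\<forall>\<^sub>F w in at z within pairs. w \<notin> touching side2 \<union> touching side3"
proof -
  have "open (- (touching side2 \<union> touching side3))"
    by (intro open_Compl closed_Un closed_touching compact_sides)
  then show ?thesis using topological_tendstoD[OF tendsto_ident_at] assms by fastforce
qed

lemma eventually_inscribed_near_proper:
  assumes z: "z \<in> inscribed" "z \<notin> touching side2 \<union> touching side3" "z \<in> proper_pairs"
  shows "\<forall>\<^sub>F w in at z within pairs. w \<in> inscribed"
proof -
  obtain s1 s2 where s: "z = (s1, s2)" "t1 \<le> s1" "s1 < s2" "s2 \<le> t2"
    using z(3) by (auto simp: proper_pairs_def)
  have "z \<in> pairs" using z(1) by (simp add: inscribed_def)
  have inside: "\<forall>\<^sub>F w in at z within pairs. place w q \<in> inside T" if q: "q = -pi/2 \<or> q = pi" for q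
  proof (rule topological_tendstoD[OF place_tendsto[OF _ \<open>z \<in> pairs\<close>] open_inside_T])
    show "q \<in> I" using q cusp_and_apex_in_I by blast
    then have "place z q \<in> closure (inside T)" using z(1) by (simp add: inscribed_def)
    moreover have "place z q \<notin> T"
      unfolding s(1)
      by (rule place_avoids_T[OF s(2-) z(2)[unfolded s(1)] cusp_and_apex_not_feet[OF s(2-) q]])
    ultimately show "place z q \<in> inside T"
      using frontier_inside_T closure_Un_frontier[of "inside T"] by blast
  qed
  have "((\<lambda>w. snd w - fst w) \<longlongrightarrow> s2 - s1) (at z within pairs)"
    unfolding s(1) by (auto intro!: tendsto_eq_intros)
  then have "\<forall>\<^sub>F w in at z within pairs. snd w - fst w > 0" by (rule order_tendstoD(1)) (use s in simp)
  then show ?thesis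
    using inside[OF disjI1[OF refl]] inside[OF disjI2[OF refl]] eventually_in_pairs
      eventually_not_touching[OF z(2)]
  proof eventually_elim
    case (elim w)
    then show ?case
      using inscribed_if_cusp_and_apex_inside[of "fst w" "snd w"] by (auto simp: pairs_def)
  qed
qed

lemma inscribed_if_in_ball:
  assumes s: "t1 < s1" "s1 < s2" "s2 < t2" and free: "(s1, s2) \<notin> touching side2 \<union> touching side3"
    and ball: "ball w e \<inter> (side2 \<union> side3) = {}" "g s1 \<in> ball w e" "g s2 \<in> ball w e"
      "place (s1, s2) (-pi/2) \<in> ball w e" "place (s1, s2) pi \<in> ball w e"
  shows "(s1, s2) \<in> inscribed"
proof -
  have s': "t1 \<le> s1" "s1 < s2" "s2 \<le> t2" using s by simp_all
  have "place (s1, s2) q \<in> inside T" if q: "q = -pi/2 \<or> q = pi" for q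
  proof -
    have "arc.height s1 (place (s1, s2) q) > 0 \<or> arc.height s2 (place (s1, s2) q) > 0"
      by (rule place_above_one_tangent[OF s' cusp_and_apex_not_feet[OF s' q]])
    moreover have "place (s1, s2) q \<in> ball w e" using q ball by blast
    moreover have "s1 < t2" "t1 < s2" using s by simp_all
    ultimately show ?thesis
      using half_ball_inside[OF _ _ _ ball(1)] ball(2,3) s(1,3) by blast
  qed
  then show ?thesis by (intro inscribed_if_cusp_and_apex_inside[OF s' free]) blast+
qed

lemma eventually_inscribed_near_diagonal:
  assumes s: "t1 < s" "s < t2" and free: "(s, s) \<notin> touching side2 \<union> touching side3"
  shows "\<forall>\<^sub>F w in at (s, s) within pairs. w \<in> inscribed"
proof -
  let ?F = "at (s, s) within pairs"
  have "closed (side2 \<union> side3)" using compact_sides by (intro closed_Un compact_imp_closed)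
  moreover have "g s \<notin> side2 \<union> side3" using arc_meets_side2[of s] arc_meets_side3[of s] s by auto
  ultimately obtain e where e: "e > 0" "ball (g s) e \<inter> (side2 \<union> side3) = {}"
    by (metis Compl_iff open_Compl openE disjoint_eq_subset_Compl)
  have near: "\<forall>\<^sub>F w in ?F. f w \<in> ball (g s) e" if "(f \<longlongrightarrow> g s) ?F" for f
    using topological_tendstoD[OF that open_ball] e(1) by simp
  have diag: "(s, s) \<in> pairs" using s by (simp add: pairs_def)
  have place: "((\<lambda>w. place w q) \<longlongrightarrow> g s) ?F" if "q \<in> I" for q
    using place_tendsto[OF that diag] by (simp add: place_diagonal)
  have coords: "(fst \<longlongrightarrow> s) ?F" "(snd \<longlongrightarrow> s) ?F" by (auto intro!: tendsto_eq_intros)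
  have "isCont g s"
    using jordan_param_continuous[OF jordan, of UNIV] by (simp add: continuous_on_eq_continuous_at)
  then have contacts: "((\<lambda>w. g (fst w)) \<longlongrightarrow> g s) ?F" "((\<lambda>w. g (snd w)) \<longlongrightarrow> g s) ?F"
    using isCont_tendsto_compose coords by blast+
  have "\<forall>\<^sub>F w in ?F. t1 < fst w" "\<forall>\<^sub>F w in ?F. snd w < t2"
    using order_tendstoD coords s by blast+
  with near[OF contacts(1)] near[OF contacts(2)] near[OF place[OF cusp_and_apex_in_I(1)]]
    near[OF place[OF cusp_and_apex_in_I(2)]] eventually_in_pairs eventually_not_touching[OF free]
  show ?thesis
  proof eventually_elim
    case (elim w)
    have "w \<in> pairs" by (fact elim)
    then show ?case
    proof (cases rule: pairs_cases)
      case (proper x y)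
      then show ?thesis using inscribed_if_in_ball[of x y "g s" e] elim e(2) by simp
    next
      case (diagonal x)
      then show ?thesis using diagonal_inscribed[of x] by simp
    qed
  qed
qed

lemma openin_inscribed_not_touching:
  "openin (top_of_set pairs) (inscribed - (touching side2 \<union> touching side3))"
proof (rule openin_if_eventually_within)
  show "inscribed - (touching side2 \<union> touching side3) \<subseteq> pairs" by (auto simp: inscribed_def)
  fix z assume z: "z \<in> inscribed - (touching side2 \<union> touching side3)"
  then have "z \<in> pairs" by (auto simp: inscribed_def)
  then have "\<forall>\<^sub>F w in at z within pairs. w \<in> inscribed"
  proof (cases rule: pairs_cases)
    case proper
    then show ?thesis using eventually_inscribed_near_proper z by blast
  next
    case (diagonal s)
    then have "place z pi = g s" by (simp add: place_diagonal)
    then have "g s \<notin> side2" "g s \<notin> side3"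
      using touchingI[OF \<open>z \<in> pairs\<close> cusp_and_apex_in_I(2)] z by auto
    then have "s \<noteq> t1" "s \<noteq> t2" using corners_on_sides by auto
    then show ?thesis using eventually_inscribed_near_diagonal[of s] diagonal z by simp
  qed
  moreover have "\<forall>\<^sub>F w in at z within pairs. w \<notin> touching side2 \<union> touching side3"
    using z by (intro eventually_not_touching) simp
  ultimately show "\<forall>\<^sub>F w in at z within pairs. w \<in> inscribed - (touching side2 \<union> touching side3)"
    by eventually_elim simp
qed

lemma inscribed_touching_both_sides: "inscribed \<inter> touching side2 \<inter> touching side3 \<noteq> {}"
proof (rule exit_sets_meet)
  let ?L = "(\<lambda>s. (s, s)) ` {t1..t2}" and ?X = "(\<lambda>s. (s, t2)) ` {t1..t2}" and ?Y = "(\<lambda>s. (t1, s)) ` {t1..t2}"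
  show "contractible pairs" by (rule convex_imp_contractible[OF convex_pairs])
  show "closedin (top_of_set pairs) inscribed" "closedin (top_of_set pairs) (touching side2)"
    "closedin (top_of_set pairs) (touching side3)"
    using closed_inscribed closed_touching compact_sides
    by (auto intro!: closed_subset simp: inscribed_def touching_def)
  show "connected ?L" "connected ?X" "connected ?Y"
    by (auto intro!: connected_continuous_image continuous_intros)
  show "?L \<subseteq> inscribed" using diagonal_inscribed by auto
  have "(s, t2) \<in> touching side2" "(t1, s) \<in> touching side3" if "s \<in> {t1..t2}" for s
    using place_hits_contacts(2)[of s t2] place_hits_contacts(1)[of t1 s] corners_on_sides that t1_less_t2
    by (force simp: touching_def pairs_def)+
  then show "?X \<subseteq> touching side2" "?Y \<subseteq> touching side3" by auto
  have "(t2, t2) \<in> ?X \<inter> ?L" "(t1, t1) \<in> ?Y \<inter> ?L" "(t1, t2) \<in> ?X \<inter> ?Y" using t1_less_t2 by auto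
  then show "?X \<inter> ?L \<noteq> {}" "?Y \<inter> ?L \<noteq> {}" "?X \<inter> ?Y \<noteq> {}" by blast+
qed (rule openin_inscribed_not_touching)

lemma touching_both_sides_proper: "touching side2 \<inter> touching side3 \<subseteq> proper_pairs"
proof
  fix z assume z: "z \<in> touching side2 \<inter> touching side3"
  then have "z \<in> pairs" by (simp add: touching_def)
  then show "z \<in> proper_pairs"
  proof (cases rule: pairs_cases)
    case (diagonal s)
    then have "g s \<in> side2" "g s \<in> side3" using z by (auto simp: touching_def place_diagonal)
    then have "s = t2" "s = t1" using arc_meets_side2[of s] arc_meets_side3[of s] diagonal by auto
    then show ?thesis using t1_less_t2 by simp
  qed
qed

lemma place_image_inter_arc:
  assumes s: "t1 \<le> s1" "s1 < s2" "s2 \<le> t2"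
  shows "place (s1, s2) ` I \<inter> g ` {t1..t2} = {g s1, g s2}"
proof
  show "place (s1, s2) ` I \<inter> g ` {t1..t2} \<subseteq> {g s1, g s2}"
    using place_meets_arc_at_feet[OF s] place_feet[OF s] by force
  show "{g s1, g s2} \<subseteq> place (s1, s2) ` I \<inter> g ` {t1..t2}"
    using place_hits_contacts[of s1 s2] s by (force simp: pairs_def)
qed

lemma inscribed_copy_exists:
  obtains a b where "a \<noteq> 0" "(\<lambda>w. a * w + b) ` K ` I \<subseteq> closure (inside T)"
    "(\<lambda>w. a * w + b) ` K ` I \<inter> side2 \<noteq> {}" "(\<lambda>w. a * w + b) ` K ` I \<inter> side3 \<noteq> {}"
    "card ((\<lambda>w. a * w + b) ` K ` I \<inter> g ` {t1..t2}) = 2"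
proof -
  obtain z where z: "z \<in> inscribed" "z \<in> touching side2" "z \<in> touching side3"
    using inscribed_touching_both_sides by blast
  then obtain s1 s2 where s: "z = (s1, s2)" "t1 \<le> s1" "s1 < s2" "s2 \<le> t2"
    using touching_both_sides_proper by (auto simp: proper_pairs_def)
  have image: "(\<lambda>w. factor z * w + offset z) ` K ` I = place z ` I"
    by (simp add: image_image place_def)
  have "g s2 \<noteq> g s1" using arc.chord_angle[OF s(2-)] by blast
  then have "card (place z ` I \<inter> g ` {t1..t2}) = 2"
    unfolding s(1) place_image_inter_arc[OF s(2-)] by simp
  moreover have "place z ` I \<subseteq> closure (inside T)" "place z ` I \<inter> side2 \<noteq> {}" "place z ` I \<inter> side3 \<noteq> {}"
    using z by (auto simp: inscribed_def touching_def)
  moreover have "factor z \<noteq> 0" unfolding s(1) by (rule factor_nonzero[OF s(2-)])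
  ultimately show thesis using that[of "factor z" "offset z"] unfolding image by blast
qed

end

theorem theorem4p4:
  fixes C T :: "complex set" and g :: "real \<Rightarrow> complex" and t1 t2 t3 :: real
  assumes "cardioid_like C"
    and "deltoid_like T"
    and "deltoid_param g t1 t2 t3" and "T = path_image g"
    and "concave_arc g t1 t2"
  shows "\<exists>\<phi>. similarity \<phi> \<and>
           \<phi> ` C \<subseteq> closure (inside T) \<and>
           \<phi> ` C \<inter> g ` {t1..t2} \<noteq> {} \<and>
           \<phi> ` C \<inter> g ` {t2..t3} \<noteq> {} \<and>
           \<phi> ` C \<inter> g ` {t3..t1 + 1} \<noteq> {} \<and>
           card (\<phi> ` C \<inter> g ` {t1..t2}) = 2"
proof -
  obtain K a b where K: "cardioid_by_angle K" "a \<noteq> 0" "K ` {-pi/2..5*pi/2} = (\<lambda>z. a * z + b) ` C"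
    by (rule cardioid_like_by_angle[OF assms(1)])
  obtain \<theta> where \<theta>: "concave_turning_arc g \<theta> t1 t2"
    by (rule deltoid_concave_turning_arc[OF assms(3,5)])
  interpret inscription K g \<theta> t1 t2 t3
    using K(1) \<theta> assms(3)
    by (simp add: inscription_def resting_cardioid_def inscription_axioms_def deltoid_param_def)
  obtain c d where "c \<noteq> 0" and copy: "(\<lambda>w. c * w + d) ` K ` I \<subseteq> closure (inside T)"
    "(\<lambda>w. c * w + d) ` K ` I \<inter> side2 \<noteq> {}" "(\<lambda>w. c * w + d) ` K ` I \<inter> side3 \<noteq> {}"
    "card ((\<lambda>w. c * w + d) ` K ` I \<inter> g ` {t1..t2}) = 2"
    unfolding assms(4) by (rule inscribed_copy_exists)
  define \<phi> where "\<phi> z = (c * a) * z + (c * b + d)" for z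
  have "similarity \<phi>" using \<open>c \<noteq> 0\<close> K(2) unfolding similarity_def \<phi>_def by (intro exI conjI) auto
  moreover have "(\<lambda>w. c * w + d) ` K ` I = \<phi> ` C"
    unfolding K(3) image_image \<phi>_def by (simp add: algebra_simps)
  ultimately show ?thesis using copy by (intro exI[of _ \<phi>]) force
qed

end
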